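(* Let $k$ be a field, let $n>1$ and $s$ be positive integers, and let $V\subset k^s$ be an irreducible algebraic subset, different from a point, which admits a regular point. (a) If $s_n(k)<\infty$, then $$w_n(k[V])\geq\max\{w_m(k),\,s_m(k)+1\}\quad\text{and}\quad w_n(k(V))\geq s_m(k)+1,$$ where $m$ is the $\mathrm{char}(k)$-free part of $n$. (b) If $s_n(k)=\infty$, then $$w_n(k[V])\geq w_n(k(V))\geq w_n(k).$$
   Context: For a commutative ring $A$ and a positive integer $n$: the $n$th level $s_n(A)$ is the smallest positive integer $g$ such that $-1$ is a sum of $g$ $n$th powers of elements of $A$ ($\infty$ if none); the $n$th Waring number $w_n(A)$ is the smallest positive integer $g$ such that every element of $A$ that is a sum of (finitely many) $n$th powers is a sum of at most $g$ $n$th powers ($\infty$ if none). For a prime $p$ and $n=p^{j}m$ with $p\nmid m$, $j\ge 0$, the $p$-free part of $n$ is $m$; the $0$-free part of $n$ is $n$ itself. For an algebraic set $V\subset k^s$ (the set of common zeros in $k^s$ of a set of polynomials), $I(V)\subset k[x_1,\dots,x_s]$ is the ideal of polynomials vanishing on $V$, $k[V]=k[x_1,\dots,x_s]/I(V)$ is its coordinate ring, and, for $V$ irreducible, $k(V)$ is the field of fractions of $k[V]$. A point $x\in V$ is regular if $k[V]_{\mathfrak{m}_x}$ is a regular local ring, where $\mathfrak{m}_x$ is the maximal ideal of polynomial functions vanishing at $x$.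
   Formalization: In (a), the bounds by s_m(k)+1 are claimed only for m≠1; if m=1 (n a power of char k), every sum of n-th powers is an n-th power, so w_n(k[V])=w_n(k(V))=1<2=s_1(k)+1; only w_n(k[V])≥w_m(k) is kept then. *)

theory Defs
  imports
    "HOL-Algebra.Algebraic_Closure_Type"
    "HOL-Algebra.Ring_Divisibility"
    "HOL-Library.Poly_Mapping"
    "HOL-Library.Extended_Nat"
    "HOL-Analysis.Finite_Cartesian_Product"
begin

section \<open>Levels and Waring numbers\<close>

definition sum_of_powers :: "('a, 'b) ring_scheme \<Rightarrow> nat \<Rightarrow> nat \<Rightarrow> 'a \<Rightarrow> bool" where
  "sum_of_powers R n g x \<longleftrightarrow>
     (\<exists>f. (\<forall>i<g. f i \<in> carrier R) \<and> x = (\<Oplus>\<^bsub>R\<^esub>i\<in>{..<g}. f i [^]\<^bsub>R\<^esub> n))"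

text \<open>In both definitions the infimum of the empty set is \<open>\<infinity>\<close>.\<close>

definition level :: "nat \<Rightarrow> ('a, 'b) ring_scheme \<Rightarrow> enat" where
  "level n R = Inf {enat g | g. 0 < g \<and> sum_of_powers R n g (\<ominus>\<^bsub>R\<^esub> \<one>\<^bsub>R\<^esub>)}"

definition waring_number :: "nat \<Rightarrow> ('a, 'b) ring_scheme \<Rightarrow> enat" where
  "waring_number n R = Inf {enat g | g. 0 < g \<and>
     (\<forall>x\<in>carrier R. (\<exists>h. sum_of_powers R n h x) \<longrightarrow> (\<exists>h\<le>g. sum_of_powers R n h x))}"

definition free_part :: "nat \<Rightarrow> nat \<Rightarrow> nat" where
  "free_part p n = (if p = 0 then n else n div p ^ multiplicity p n)"


section \<open>Localizations and regular local rings\<close>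

text \<open>For a multiplicative subset \<open>S\<close> of a commutative ring \<open>R\<close>, the elements of
  \<open>localization R S\<close> are the classes of pairs \<open>(a, s)\<close>, standing for \<open>a / s\<close>.\<close>

definition fraction_rel :: "('a, 'b) ring_scheme \<Rightarrow> 'a set \<Rightarrow> (('a \<times> 'a) \<times> ('a \<times> 'a)) set" where
  "fraction_rel R S = {((a, s), (b, t)). a \<in> carrier R \<and> s \<in> S \<and> b \<in> carrier R \<and> t \<in> S \<and>
     (\<exists>u\<in>S. u \<otimes>\<^bsub>R\<^esub> (a \<otimes>\<^bsub>R\<^esub> t \<ominus>\<^bsub>R\<^esub> b \<otimes>\<^bsub>R\<^esub> s) = \<zero>\<^bsub>R\<^esub>)}"

definition fraction :: "('a, 'b) ring_scheme \<Rightarrow> 'a set \<Rightarrow> 'a \<Rightarrow> 'a \<Rightarrow> ('a \<times> 'a) set" where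
  "fraction R S a s = fraction_rel R S `` {(a, s)}"

definition localization :: "('a, 'b) ring_scheme \<Rightarrow> 'a set \<Rightarrow> ('a \<times> 'a) set ring" where
  "localization R S =
    \<lparr>carrier = (carrier R \<times> S) // fraction_rel R S,
     monoid.mult = (\<lambda>A B. \<Union>x\<in>A. \<Union>y\<in>B.
              fraction R S (fst x \<otimes>\<^bsub>R\<^esub> fst y) (snd x \<otimes>\<^bsub>R\<^esub> snd y)),
     one = fraction R S \<one>\<^bsub>R\<^esub> \<one>\<^bsub>R\<^esub>,
     zero = fraction R S \<zero>\<^bsub>R\<^esub> \<one>\<^bsub>R\<^esub>,
     add = (\<lambda>A B. \<Union>x\<in>A. \<Union>y\<in>B.
              fraction R S (fst x \<otimes>\<^bsub>R\<^esub> snd y \<oplus>\<^bsub>R\<^esub> fst y \<otimes>\<^bsub>R\<^esub> snd x)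
                (snd x \<otimes>\<^bsub>R\<^esub> snd y))\<rparr>"

definition fraction_field :: "('a, 'b) ring_scheme \<Rightarrow> ('a \<times> 'a) set ring" where
  "fraction_field R = localization R (carrier R - {\<zero>\<^bsub>R\<^esub>})"

definition krull_dim :: "('a, 'b) ring_scheme \<Rightarrow> enat" where
  "krull_dim R = Sup {enat d | d. \<exists>P. (\<forall>i\<le>d. primeideal (P i) R) \<and> (\<forall>i<d. P i \<subset> P (Suc i))}"

definition regular_local_ring :: "('a, 'b) ring_scheme \<Rightarrow> bool" where
  "regular_local_ring R \<longleftrightarrow> cring R \<and> noetherian_ring R \<and> (\<exists>!M. maximalideal M R) \<and>
     (\<exists>G. G \<subseteq> carrier R \<and> finite G \<and> maximalideal (genideal R G) R \<and>
          enat (card G) = krull_dim R)"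


section \<open>Affine algebraic sets\<close>

text \<open>Polynomials over the field \<open>'k\<close> in the indeterminates \<open>x\<^sub>i\<close>, for \<open>i\<close> in the finite
  type \<open>'s\<close>, are finitely supported functions from exponent vectors to coefficients; the
  multiplication on this type is convolution.\<close>

type_synonym ('s, 'k) mpoly = "('s \<Rightarrow>\<^sub>0 nat) \<Rightarrow>\<^sub>0 'k"

definition mpoly_eval :: "'k::field ^ 's::finite \<Rightarrow> ('s, 'k) mpoly \<Rightarrow> 'k" where
  "mpoly_eval x p = (\<Sum>e\<in>Poly_Mapping.keys p.
     Poly_Mapping.lookup p e * (\<Prod>i\<in>UNIV. (x $ i) ^ Poly_Mapping.lookup e i))"

definition algebraic_set :: "('k::field ^ 's::finite) set \<Rightarrow> bool" where
  "algebraic_set V \<longleftrightarrow> (\<exists>P. V = {x. \<forall>p\<in>P. mpoly_eval x p = 0})"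

definition irreducible_algebraic_set :: "('k::field ^ 's::finite) set \<Rightarrow> bool" where
  "irreducible_algebraic_set V \<longleftrightarrow> algebraic_set V \<and> V \<noteq> {} \<and>
     (\<forall>V1 V2. algebraic_set V1 \<and> algebraic_set V2 \<and> V = V1 \<union> V2 \<longrightarrow> V = V1 \<or> V = V2)"

definition base_field :: "'k::field itself \<Rightarrow> 'k ring" where
  "base_field _ = ring_of_type_algebra"

abbreviation mpoly_ring :: "('s, 'k::field) mpoly ring" where
  "mpoly_ring \<equiv> ring_of_type_algebra"

definition vanishing_ideal :: "('k::field ^ 's::finite) set \<Rightarrow> ('s, 'k) mpoly set" where
  "vanishing_ideal V = {p. \<forall>x\<in>V. mpoly_eval x p = 0}"

definition coordinate_ring :: "('k::field ^ 's::finite) set \<Rightarrow> ('s, 'k) mpoly set ring" where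
  "coordinate_ring V = mpoly_ring Quot vanishing_ideal V"

definition function_field ::
    "('k::field ^ 's::finite) set \<Rightarrow> (('s, 'k) mpoly set \<times> ('s, 'k) mpoly set) set ring" where
  "function_field V = fraction_field (coordinate_ring V)"

definition point_ideal ::
    "('k::field ^ 's::finite) set \<Rightarrow> 'k ^ 's \<Rightarrow> ('s, 'k) mpoly set set" where
  "point_ideal V x = {vanishing_ideal V +>\<^bsub>mpoly_ring\<^esub> p | p. mpoly_eval x p = 0}"

definition regular_point :: "('k::field ^ 's::finite) set \<Rightarrow> 'k ^ 's \<Rightarrow> bool" where
  "regular_point V x \<longleftrightarrow> x \<in> V \<and>
     regular_local_ring
       (localization (coordinate_ring V) (carrier (coordinate_ring V) - point_ideal V x))"

end

(* Let P be the polynomial ring, I the ideal of V and M the maximal ideal of a regular point x.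
   If t_1, ..., t_d are regular parameters, then the ideals (t_1, ..., t_i) of the local ring at x
   form a chain of primes, so a diagonal form sum c_i X_i^n that has only the trivial zero over the
   residue field k has only the trivial zero in k(V): going down the chain, a zero whose
   coordinates are all divisible by t_(i+1) modulo (t_1, ..., t_i) can be divided by t_(i+1), and
   this stops by the ascending chain condition. For infinite level this is applied to
   X_1^n + ... + X_g^n - c X_0^n. For finite level and s = s_m(k), with
   -1 = a_1^m + ... + a_s^m, the element f = (1 + t_1)^m + a_1^m + ... + a_s^m = t_1 * unit is a
   sum of s + 1 powers, and X_1^m + ... + X_s^m - f X_0^m has no nontrivial zero since
   X_1^m + ... + X_s^m has none over k and f has order 1. In characteristic p everything is raised
   to the power n / m of p, which is additive. That the chain consists of primes follows from
   Krull's principal ideal theorem: a chain of d + 1 primes can be pushed into one of d primes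
   containing t_1. *)
theory Submission
  imports Defs
begin

section \<open>Regular parameters and anisotropic forms\<close>

text \<open>The obstacle is the function field: an identity there has denominators that may vanish
  at the regular point, so evaluation at that point says nothing about it. Anisotropy is the
  homogeneous substitute. After denominators are cleared, the common denominator becomes the value
  of one extra coordinate, and that coordinate lies outside \<open>I\<close>, so the zero obtained
  is nontrivial.

  The hypotheses act at single places. The point has coordinates in k, so its residue field is k
  itself and anisotropy modulo \<open>M\<close> is a statement about k. V is not a point, so
  \<open>I\<close> differs from \<open>M\<close> and a first parameter exists. The characteristic
  does not divide m, so (1 + t)^m - 1 is t times an element whose value at the point is m, which is
  nonzero; this is why the free part of n appears. Finally m > 1 makes the m-th power of a multiple
  of t divisible by t^2, so order one cannot be reached by m-th powers alone.\<close>

definition cideal :: "'a::comm_ring_1 set \<Rightarrow> bool" where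
  "cideal J \<longleftrightarrow> 0 \<in> J \<and> (\<forall>a\<in>J. \<forall>b\<in>J. a + b \<in> J) \<and> (\<forall>r. \<forall>a\<in>J. r * a \<in> J)"

definition cprime :: "'a::comm_ring_1 set \<Rightarrow> bool" where
  "cprime P \<longleftrightarrow> cideal P \<and> 1 \<notin> P \<and> (\<forall>a b. a * b \<in> P \<longrightarrow> a \<in> P \<or> b \<in> P)"

text \<open>For a prime ideal \<open>M\<close>, the saturated ideals are the contractions of the ideals of the
  localization at \<open>M\<close>; they stand in for ideals of the local ring, so that all computations take
  place in the original ring. Then \<open>adjoin M J g\<close> below represents the ideal generated by \<open>J\<close> and
  \<open>g\<close>.\<close>

definition saturated :: "'a::comm_ring_1 set \<Rightarrow> 'a set \<Rightarrow> bool" where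
  "saturated M J \<longleftrightarrow> cideal J \<and> (\<forall>u a. u \<notin> M \<longrightarrow> u * a \<in> J \<longrightarrow> a \<in> J)"

definition adjoin :: "'a::comm_ring_1 set \<Rightarrow> 'a set \<Rightarrow> 'a \<Rightarrow> 'a set" where
  "adjoin M J g = {a. \<exists>u r. u \<notin> M \<and> u * a - r * g \<in> J}"

section \<open>Calculus of ideals, primes and saturation\<close>

lemma cideal_zero: "cideal J \<Longrightarrow> 0 \<in> J"
  and cideal_add: "cideal J \<Longrightarrow> a \<in> J \<Longrightarrow> b \<in> J \<Longrightarrow> a + b \<in> J"
  and cideal_mult: "cideal J \<Longrightarrow> a \<in> J \<Longrightarrow> r * a \<in> J"
  by (auto simp: cideal_def)

lemma cideal_mult2: "cideal J \<Longrightarrow> a \<in> J \<Longrightarrow> a * r \<in> J"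
  by (metis cideal_mult mult.commute)

lemma cideal_uminus: "cideal J \<Longrightarrow> a \<in> J \<Longrightarrow> - a \<in> J"
  using cideal_mult[of J a "- 1"] by simp

lemma cideal_diff: "cideal J \<Longrightarrow> a \<in> J \<Longrightarrow> b \<in> J \<Longrightarrow> a - b \<in> J"
  using cideal_add[of J a "- b"] cideal_uminus[of J b] by simp

lemma cideal_diff_iff: "cideal J \<Longrightarrow> a - b \<in> J \<Longrightarrow> a \<in> J \<longleftrightarrow> b \<in> J"
  using cideal_add[of J "a - b" b] cideal_diff[of J a "a - b"] by auto

lemma cideal_sum: "cideal J \<Longrightarrow> (\<And>i. i \<in> A \<Longrightarrow> f i \<in> J) \<Longrightarrow> sum f A \<in> J"
  by (induction A rule: infinite_finite_induct) (auto intro: cideal_zero cideal_add)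

lemma cprime_cideal: "cprime P \<Longrightarrow> cideal P"
  and cprime_one: "cprime P \<Longrightarrow> 1 \<notin> P"
  and cprime_mult: "cprime P \<Longrightarrow> a * b \<in> P \<Longrightarrow> a \<notin> P \<Longrightarrow> b \<in> P"
  unfolding cprime_def by blast+

lemma cprime_power: "cprime P \<Longrightarrow> a ^ n \<in> P \<Longrightarrow> a \<in> P"
  by (induction n) (auto simp: cprime_one dest: cprime_mult)

lemma cprime_prod: "cprime P \<Longrightarrow> (\<And>i. i \<in> A \<Longrightarrow> f i \<notin> P) \<Longrightarrow> prod f A \<notin> P"
  by (induction A rule: infinite_finite_induct) (auto simp: cprime_one dest: cprime_mult)

lemma saturated_cideal: "saturated M J \<Longrightarrow> cideal J"
  and saturatedD: "saturated M J \<Longrightarrow> u \<notin> M \<Longrightarrow> u * a \<in> J \<Longrightarrow> a \<in> J"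
  unfolding saturated_def by blast+

lemma cprime_saturated: "cprime P \<Longrightarrow> P \<subseteq> M \<Longrightarrow> saturated M P"
  unfolding saturated_def using cprime_cideal cprime_mult by blast

lemma saturated_proper: "saturated M J \<Longrightarrow> 1 \<notin> J \<Longrightarrow> J \<subseteq> M"
  using saturatedD[of M J _ 1] by auto

lemma saturated_mono: "saturated Q J \<Longrightarrow> Q \<subseteq> M \<Longrightarrow> saturated M J"
  unfolding saturated_def by blast

lemma saturated_Inter:
  assumes "\<And>J. J \<in> C \<Longrightarrow> saturated M J"
  shows "saturated M (\<Inter> C)"
proof -
  have "cideal J" if "J \<in> C" for J using assms[OF that] by (rule saturated_cideal)
  then have "cideal (\<Inter> C)"
    unfolding cideal_def by (intro conjI ballI allI InterI) (blast dest: InterD)+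
  then show ?thesis
    unfolding saturated_def using saturatedD[OF assms] by (blast intro: InterI dest: InterD)
qed

lemma adjoinI: "u \<notin> M \<Longrightarrow> u * a - r * g \<in> J \<Longrightarrow> a \<in> adjoin M J g"
  unfolding adjoin_def by blast

lemma saturated_adjoin:
  assumes M: "cprime M" and J: "cideal J"
  shows "saturated M (adjoin M J g)"
  unfolding saturated_def cideal_def
proof (intro conjI allI ballI impI)
  note M1 = cprime_one[OF M] and Mm = cprime_mult[OF M]
  show "0 \<in> adjoin M J g"
    by (rule adjoinI[of 1 _ _ 0]) (auto simp: M1 J cideal_zero)
  fix a b r
  assume "a \<in> adjoin M J g"
  then obtain u s where a: "u \<notin> M" "u * a - s * g \<in> J" unfolding adjoin_def by blast
  have "u * (r * a) - (r * s) * g = r * (u * a - s * g)" by (simp add: algebra_simps)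
  then show "r * a \<in> adjoin M J g"
    using a cideal_mult[OF J] by (metis adjoinI)
  assume "b \<in> adjoin M J g"
  then obtain v t where b: "v \<notin> M" "v * b - t * g \<in> J" unfolding adjoin_def by blast
  have "(u * v) * (a + b) - (v * s + u * t) * g = v * (u * a - s * g) + u * (v * b - t * g)"
    by (simp add: algebra_simps)
  moreover have "v * (u * a - s * g) + u * (v * b - t * g) \<in> J"
    by (intro cideal_add cideal_mult J a b)
  ultimately show "a + b \<in> adjoin M J g"
    using Mm[of u v] a(1) b(1) by (metis adjoinI)
next
  fix u a
  assume u: "u \<notin> M" and "u * a \<in> adjoin M J g"
  then obtain v r where v: "v \<notin> M" "v * (u * a) - r * g \<in> J" unfolding adjoin_def by blast
  show "a \<in> adjoin M J g"
    by (rule adjoinI[of "v * u" _ _ r]) (use v u cprime_mult[OF M] in \<open>auto simp: mult.assoc\<close>)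
qed

lemma adjoin_superset: "cprime M \<Longrightarrow> J \<subseteq> adjoin M J g"
  by (rule subsetI, rule adjoinI[of 1 _ _ 0]) (auto simp: cprime_one)

lemma adjoin_self: "cprime M \<Longrightarrow> cideal J \<Longrightarrow> g \<in> adjoin M J g"
  by (rule adjoinI[of 1 _ _ 1]) (auto simp: cprime_one cideal_zero)

lemma adjoin_least:
  assumes K: "saturated M K" and "J \<subseteq> K" and g: "g \<in> K"
  shows "adjoin M J g \<subseteq> K"
proof
  fix a assume "a \<in> adjoin M J g"
  then obtain u r where ur: "u \<notin> M" "u * a - r * g \<in> K" using assms(2) unfolding adjoin_def by blast
  note idK = saturated_cideal[OF K]
  have "u * a \<in> K" using cideal_diff_iff[OF idK ur(2)] cideal_mult[OF idK g] by blast
  then show "a \<in> K" using saturatedD[OF K ur(1)] by blast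
qed

lemma adjoin_mono: "J \<subseteq> K \<Longrightarrow> adjoin M J g \<subseteq> adjoin M K g"
  unfolding adjoin_def by blast

text \<open>The maximality condition says that \<open>P\<^sub>M / I P\<^sub>M\<close> is noetherian, where \<open>P\<close> is the ambient ring.\<close>

locale local_noetherian =
  fixes M I :: "'a::comm_ring_1 set"
  assumes prime_M: "cprime M"
    and maximal_exists: "J \<in> C \<Longrightarrow> (\<And>J. J \<in> C \<Longrightarrow> saturated M J \<and> I \<subseteq> J) \<Longrightarrow>
      \<exists>J\<in>C. \<forall>K\<in>C. J \<subseteq> K \<longrightarrow> K = J"
begin

section \<open>Nakayama's lemma and Krull's principal ideal theorem\<close>

text \<open>Finite generation is replaced by a maximal saturated \<open>L\<close> with
  \<open>K\<close> \<subseteq> \<open>L\<close> \<subset> \<open>J\<close>: over such an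
  \<open>L\<close> the ideal \<open>J\<close> is generated by any single \<open>g\<close> outside
  \<open>L\<close>. Up to units \<open>g\<close> is then \<open>s * x * g\<close> modulo
  \<open>L\<close>, and a unit minus \<open>s * x\<close> is again a unit because \<open>x\<close>
  lies in \<open>M\<close>.\<close>

lemma nakayama:
  assumes J: "saturated M J" and K: "saturated M K" and "I \<subseteq> K" "K \<subseteq> J" and x: "x \<in> M"
    and gen: "\<And>a. a \<in> J \<Longrightarrow> \<exists>u r. u \<notin> M \<and> r \<in> J \<and> u * a - r * x \<in> K"
  shows "J \<subseteq> K"
proof (rule ccontr)
  assume "\<not> J \<subseteq> K"
  define C where "C = {L. saturated M L \<and> K \<subseteq> L \<and> L \<subseteq> J \<and> L \<noteq> J}"
  have "K \<in> C" using assms \<open>\<not> J \<subseteq> K\<close> by (auto simp: C_def)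
  then have "\<exists>L\<in>C. \<forall>L'\<in>C. L \<subseteq> L' \<longrightarrow> L' = L"
    by (rule maximal_exists) (use \<open>I \<subseteq> K\<close> in \<open>auto simp: C_def\<close>)
  then obtain L where L: "L \<in> C" and max: "\<And>L'. L' \<in> C \<Longrightarrow> L \<subseteq> L' \<Longrightarrow> L' = L" by blast
  have satL: "saturated M L" and idL: "cideal L" using L by (auto simp: C_def saturated_cideal)
  obtain g where g: "g \<in> J" "g \<notin> L" using L by (auto simp: C_def)
  have "adjoin M L g = J"
  proof (rule ccontr)
    assume "adjoin M L g \<noteq> J"
    then have "adjoin M L g \<in> C"
      using L g saturated_adjoin[OF prime_M idL, of g] adjoin_superset[OF prime_M, of L g]
        adjoin_least[OF J _ g(1), of L] by (auto simp: C_def)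
    from max[OF this adjoin_superset[OF prime_M]] have "adjoin M L g = L" .
    then show False using adjoin_self[OF prime_M idL, of g] g by simp
  qed
  obtain u r where ur: "u \<notin> M" "r \<in> J" "u * g - r * x \<in> K" using gen[OF g(1)] by blast
  then obtain v s where vs: "v \<notin> M" "v * r - s * g \<in> L"
    using \<open>adjoin M L g = J\<close> unfolding adjoin_def by blast
  have "(v * u - s * x) * g = v * (u * g - r * x) + x * (v * r - s * g)"
    by (simp add: algebra_simps)
  also have "\<dots> \<in> L"
    using ur vs L by (intro cideal_add cideal_mult idL) (auto simp: C_def)
  finally have "(v * u - s * x) * g \<in> L" .
  moreover have "v * u - s * x \<notin> M"
    using cideal_diff_iff[OF cprime_cideal[OF prime_M], of "v * u" "s * x"]
      cideal_mult[OF cprime_cideal[OF prime_M] x] cprime_mult[OF prime_M, of v u] ur vs by blast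
  ultimately show False using saturatedD[OF satL] g by blast
qed

text \<open>A localization of a noetherian ring is noetherian: \<open>Q\<close>-saturated ideals are
  among the \<open>M\<close>-saturated ones. This allows the principal ideal theorem to be used at
  every prime of a chain below \<open>M\<close>.\<close>

lemma restrict:
  assumes "cprime Q" "Q \<subseteq> M"
  shows "local_noetherian Q I"
proof
  show "cprime Q" by fact
  fix J and C :: "'a set set"
  assume "J \<in> C" and "\<And>J. J \<in> C \<Longrightarrow> saturated Q J \<and> I \<subseteq> J"
  then show "\<exists>J\<in>C. \<forall>K\<in>C. J \<subseteq> K \<longrightarrow> K = J"
    using maximal_exists[of J C] saturated_mono[OF _ assms(2)] by blast
qed

text \<open>A maximal annihilator \<open>(J : a)\<close> is prime, hence equal to \<open>M\<close>. Consequently a minimal prime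
  \<open>M\<close> of \<open>N\<close> yields the descending chain condition above \<open>N\<close>.\<close>

lemma socle_element:
  assumes N: "saturated M N" "I \<subseteq> N"
    and only: "\<And>P. cprime P \<Longrightarrow> N \<subseteq> P \<Longrightarrow> P \<subseteq> M \<Longrightarrow> P = M"
    and J: "saturated M J" "N \<subseteq> J" "1 \<notin> J"
  shows "\<exists>g. g \<notin> J \<and> (\<forall>r\<in>M. r * g \<in> J)"
proof -
  define colon where "colon a = {b. b * a \<in> J}" for a
  define C where "C = colon ` (- J)"
  note idJ = saturated_cideal[OF J(1)]
  have sat: "saturated M (colon a)" for a
    unfolding saturated_def cideal_def colon_def
    using cideal_zero[OF idJ]
    by (auto simp: distrib_right mult.assoc intro: cideal_add[OF idJ] cideal_mult[OF idJ]
        saturatedD[OF J(1)])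
  have "J \<subseteq> colon a" for a using cideal_mult2[OF idJ] by (auto simp: colon_def)
  then have N_colon: "N \<subseteq> colon a" for a using J by blast
  then have I_colon: "I \<subseteq> colon a" for a using \<open>I \<subseteq> N\<close> by blast
  have "colon 1 \<in> C" using J(3) by (auto simp: C_def)
  then have "\<exists>L\<in>C. \<forall>K\<in>C. L \<subseteq> K \<longrightarrow> K = L"
    by (rule maximal_exists) (use sat I_colon in \<open>auto simp: C_def\<close>)
  then obtain a where a: "a \<notin> J" and max: "\<And>b. b \<notin> J \<Longrightarrow> colon a \<subseteq> colon b \<Longrightarrow> colon b = colon a"
    unfolding C_def by blast
  have "cprime (colon a)"
    unfolding cprime_def
  proof (intro conjI allI impI)
    show "cideal (colon a)" using sat saturated_cideal by blast
    show "1 \<notin> colon a" using a by (simp add: colon_def)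
    fix b c assume bc: "b * c \<in> colon a"
    show "b \<in> colon a \<or> c \<in> colon a"
    proof (rule disjCI)
      assume "c \<notin> colon a"
      then have "c * a \<notin> J" by (simp add: colon_def)
      moreover have "colon a \<subseteq> colon (c * a)"
        unfolding colon_def using cideal_mult[OF idJ, of "_ * a" c] by (auto simp: ac_simps)
      ultimately have "colon (c * a) = colon a" by (rule max)
      moreover have "b \<in> colon (c * a)" using bc by (simp add: colon_def mult.assoc)
      ultimately show "b \<in> colon a" by simp
    qed
  qed
  then have "colon a = M"
    using only[OF _ N_colon] saturated_proper[OF sat] cprime_one by blast
  then show ?thesis using a unfolding colon_def by blast
qed

text \<open>Noetherian induction on the ideal \<open>J\<close> above which some chain fails to
  stabilize, with a socle element \<open>g\<close> over a maximal such \<open>J\<close>. If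
  \<open>g\<close> lies in every member, the chain lives above the larger ideal
  \<open>adjoin M J g\<close>. Otherwise the chain enlarged by \<open>g\<close> stabilizes, and the
  original one follows: once \<open>g\<close> has left \<open>Ks n\<close>, a multiple
  \<open>r * g\<close> in \<open>Ks n\<close> forces \<open>r\<close> into \<open>M\<close>, hence
  \<open>r * g\<close> into \<open>J\<close>, which every member contains.\<close>

lemma descending_chain:
  assumes N: "saturated M N" "I \<subseteq> N"
    and only: "\<And>P. cprime P \<Longrightarrow> N \<subseteq> P \<Longrightarrow> P \<subseteq> M \<Longrightarrow> P = M"
    and Js: "\<And>i. saturated M (Js i)" "\<And>i. N \<subseteq> Js i" "decseq Js"
  shows "\<exists>n. \<forall>i\<ge>n. Js i = Js n"
proof (rule ccontr)
  assume not: "\<not> ?thesis"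
  define bad where "bad J \<longleftrightarrow> (\<exists>Js. (\<forall>i. saturated M (Js i) \<and> J \<subseteq> Js i) \<and> decseq Js \<and>
      \<not> (\<exists>n. \<forall>i\<ge>n. Js i = Js n))" for J :: "'a set"
  define C where "C = {J. saturated M J \<and> N \<subseteq> J \<and> bad J}"
  have "N \<in> C" using N Js not unfolding C_def bad_def by blast
  then have "\<exists>J\<in>C. \<forall>K\<in>C. J \<subseteq> K \<longrightarrow> K = J"
    by (rule maximal_exists) (use N in \<open>auto simp: C_def\<close>)
  then obtain J where "J \<in> C" and max: "\<And>K. K \<in> C \<Longrightarrow> J \<subseteq> K \<Longrightarrow> K = J" by blast
  then have J: "saturated M J" "N \<subseteq> J" "bad J" by (auto simp: C_def)
  note idJ = saturated_cideal[OF J(1)]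
  obtain Ks where Ks: "\<And>i. saturated M (Ks i)" "\<And>i. J \<subseteq> Ks i" "decseq Ks"
    and Ks_not: "\<not> (\<exists>n. \<forall>i\<ge>n. Ks i = Ks n)"
    using J(3) unfolding bad_def by blast
  note idK = saturated_cideal[OF Ks(1)]
  have "1 \<notin> J"
  proof
    assume "1 \<in> J"
    then have "Ks i = UNIV" for i
      using Ks(2)[of i] cideal_mult[OF idK[of i], of 1] by auto
    then show False using Ks_not by auto
  qed
  then obtain g where g: "g \<notin> J" "\<And>r. r \<in> M \<Longrightarrow> r * g \<in> J"
    using socle_element[OF N only J(1,2)] by blast
  have good: "\<not> bad (adjoin M J g)"
  proof
    assume "bad (adjoin M J g)"
    then have "adjoin M J g \<in> C"
      using saturated_adjoin[OF prime_M idJ, of g] adjoin_superset[OF prime_M, of J g] J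
      by (auto simp: C_def)
    then show False
      using max[OF _ adjoin_superset[OF prime_M]] adjoin_self[OF prime_M idJ] g by metis
  qed
  show False
  proof (cases "\<forall>i. g \<in> Ks i")
    case True
    then have "\<And>i. adjoin M J g \<subseteq> Ks i" using adjoin_least[OF Ks(1) Ks(2)] by blast
    then have "bad (adjoin M J g)" using Ks Ks_not unfolding bad_def by blast
    then show False using good by blast
  next
    case False
    then obtain n0 where n0: "g \<notin> Ks n0" by blast
    have "\<And>i. adjoin M J g \<subseteq> adjoin M (Ks i) g" using adjoin_mono[OF Ks(2)] by blast
    moreover have "decseq (\<lambda>i. adjoin M (Ks i) g)"
      using adjoin_mono[OF decseqD[OF Ks(3)]] unfolding decseq_def by blast
    moreover note saturated_adjoin[OF prime_M idK]
    ultimately have "\<exists>n. \<forall>i\<ge>n. adjoin M (Ks i) g = adjoin M (Ks n) g"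
      using good unfolding bad_def by (metis (no_types, lifting))
    then obtain n1 where n1: "\<And>i. i \<ge> n1 \<Longrightarrow> adjoin M (Ks i) g = adjoin M (Ks n1) g"
      by blast
    define n where "n = max n0 n1"
    have "Ks i = Ks n" if i: "i \<ge> n" for i
    proof
      show "Ks i \<subseteq> Ks n" using Ks(3) i by (auto simp: decseq_def)
      show "Ks n \<subseteq> Ks i"
      proof
        fix a assume a: "a \<in> Ks n"
        then have "a \<in> adjoin M (Ks i) g"
          using n1[of n] n1[of i] i adjoin_superset[OF prime_M, of "Ks n" g] by (auto simp: n_def)
        then obtain u r where ur: "u \<notin> M" "u * a - r * g \<in> Ks i" unfolding adjoin_def by blast
        then have "u * a - r * g \<in> Ks n" using \<open>Ks i \<subseteq> Ks n\<close> by blast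
        then have "r * g \<in> Ks n"
          using cideal_diff_iff[OF idK] cideal_mult[OF idK a] by blast
        moreover have "g \<notin> Ks n" using n0 decseqD[OF Ks(3), of n0 n] by (auto simp: n_def)
        ultimately have "r \<in> M" using saturatedD[OF Ks(1)] by blast
        then have "r * g \<in> Ks i" using g Ks(2) by blast
        then have "u * a \<in> Ks i" using cideal_diff_iff[OF idK] ur by blast
        then show "a \<in> Ks i" using saturatedD[OF Ks(1)] ur by blast
      qed
    qed
    then show False using Ks_not by blast
  qed
qed

text \<open>For \<open>y\<close> in \<open>Q\<close> but not in \<open>P\<close>, let \<open>J\<^sub>n\<close> be the contraction of \<open>(y\<^sup>n)\<close> from the localization
  at \<open>Q\<close>, modulo \<open>P\<close>. If \<open>M\<close> is minimal over \<open>P + (x)\<close>, the descending chain \<open>J\<^sub>n + (x)\<close> is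
  stationary, and \<open>J\<^sub>n = J\<^bsub>n+1\<^esub> + x J\<^sub>n\<close> because \<open>x\<close> is not in \<open>Q\<close>. Nakayama's lemma gives
  \<open>J\<^sub>n = J\<^bsub>n+1\<^esub>\<close>, so \<open>y\<close> is a unit at \<open>Q\<close>, a contradiction.\<close>

lemma principal_ideal_theorem:
  assumes P: "cprime P" "I \<subseteq> P" and Q: "cprime Q" "P \<subset> Q" "Q \<subset> M" and x: "x \<in> M" "x \<notin> Q"
  shows "\<exists>Q'. cprime Q' \<and> P \<subset> Q' \<and> Q' \<subset> M \<and> x \<in> Q'"
proof (rule ccontr)
  assume none: "\<not> ?thesis"
  obtain y where y: "y \<in> Q" "y \<notin> P" using Q by blast
  note idP = cprime_cideal[OF P(1)] and idQ = cprime_cideal[OF Q(1)]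
  define N where "N = adjoin M P x"
  have N: "saturated M N" "I \<subseteq> N"
    unfolding N_def using saturated_adjoin[OF prime_M idP] adjoin_superset[OF prime_M, of P x] P by auto
  \<comment> \<open>A prime over \<open>N\<close> contains \<open>x\<close> and so is strictly
    larger than \<open>P\<close>; as no such prime lies strictly below \<open>M\<close>, the prime
    \<open>M\<close> is minimal over \<open>N\<close>.\<close>
  have only: "L = M" if L: "cprime L" "N \<subseteq> L" "L \<subseteq> M" for L
  proof -
    have "P \<subseteq> L" "x \<in> L"
      using L(2) adjoin_superset[OF prime_M, of P x] adjoin_self[OF prime_M idP, of x]
      unfolding N_def by auto
    moreover have "x \<notin> P" using x Q by blast
    ultimately show ?thesis using none L by blast
  qed
  define Js where "Js n = adjoin Q P (y ^ n)" for n
  have satQ: "saturated Q (Js n)" for n unfolding Js_def by (rule saturated_adjoin[OF Q(1) idP])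
  then have sat: "saturated M (Js n)" for n using saturated_mono Q by blast
  note idJ = saturated_cideal[OF sat]
  have PJ: "P \<subseteq> Js n" for n unfolding Js_def by (rule adjoin_superset[OF Q(1)])
  have yJ: "y ^ n \<in> Js n" for n unfolding Js_def by (rule adjoin_self[OF Q(1) idP])
  have dec: "Js (Suc n) \<subseteq> Js n" for n
    unfolding Js_def[of "Suc n"]
    by (rule adjoin_least[OF satQ PJ]) (simp add: cideal_mult[OF idJ yJ])
  have "decseq Js" using dec by (rule decseq_SucI)
  define Ks where "Ks n = adjoin M (Js n) x" for n
  have "\<exists>n. \<forall>i\<ge>n. Ks i = Ks n"
  proof (rule descending_chain[OF N only])
    show "saturated M (Ks i)" for i unfolding Ks_def by (rule saturated_adjoin[OF prime_M idJ])
    show "N \<subseteq> Ks i" for i unfolding N_def Ks_def by (rule adjoin_mono[OF PJ])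
    show "decseq Ks" unfolding Ks_def by (intro decseq_SucI adjoin_mono dec)
  qed auto
  then obtain n where n: "Ks (Suc n) = Ks n" by (metis le_Suc_eq order_refl)
  have "Js n \<subseteq> Js (Suc n)"
  proof (rule nakayama[OF sat sat _ dec x(1)])
    show "I \<subseteq> Js (Suc n)" using P PJ by blast
    fix a assume a: "a \<in> Js n"
    then have "a \<in> Ks (Suc n)" unfolding n using adjoin_superset[OF prime_M] by (auto simp: Ks_def)
    then obtain u r where ur: "u \<notin> M" "u * a - r * x \<in> Js (Suc n)"
      unfolding Ks_def adjoin_def by blast
    then have "u * a - r * x \<in> Js n" using dec by blast
    then have "x * r \<in> Js n"
      using cideal_diff_iff[OF idJ] cideal_mult[OF idJ a] by (metis mult.commute)
    then have "r \<in> Js n" using saturatedD[OF satQ] x by blast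
    then show "\<exists>u r. u \<notin> M \<and> r \<in> Js n \<and> u * a - r * x \<in> Js (Suc n)" using ur by blast
  qed
  then have "y ^ n \<in> Js (Suc n)" using yJ by blast
  then obtain s c where sc: "s \<notin> Q" "s * y ^ n - c * y ^ Suc n \<in> P"
    unfolding Js_def adjoin_def by blast
  then have "y ^ n * (s - c * y) \<in> P" by (simp add: algebra_simps)
  moreover have "y ^ n \<notin> P" using cprime_power[OF P(1)] y by blast
  ultimately have "s - c * y \<in> P" using cprime_mult[OF P(1)] by blast
  then have "s - c * y \<in> Q" using Q by blast
  then have "s \<in> Q" using cideal_diff_iff[OF idQ] cideal_mult[OF idQ y(1)] by blast
  then show False using sc by blast
qed

section \<open>Chains of primes and regular systems of parameters\<close>

text \<open>The number counts strict inclusions and only the two ends are recorded. Chains grow at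
  the top, so that the two highest links are at hand when \<open>x\<close> is pushed
  downwards.\<close>

inductive prime_chain :: "nat \<Rightarrow> 'a set \<Rightarrow> 'a set \<Rightarrow> bool" where
  prime_chain_0: "cprime P \<Longrightarrow> I \<subseteq> P \<Longrightarrow> P \<subseteq> M \<Longrightarrow> prime_chain 0 P P"
| prime_chain_Suc: "prime_chain d P Q \<Longrightarrow> cprime Q' \<Longrightarrow> Q \<subset> Q' \<Longrightarrow> Q' \<subseteq> M \<Longrightarrow>
    prime_chain (Suc d) P Q'"

lemma prime_chainD:
  assumes "prime_chain d P Q"
  shows "cprime P \<and> cprime Q \<and> I \<subseteq> P \<and> P \<subseteq> Q \<and> Q \<subseteq> M \<and> (0 < d \<longrightarrow> P \<noteq> Q)"
  using assms by induction auto

text \<open>If the second highest prime \<open>Q1\<close> misses \<open>x\<close>, the principal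
  ideal theorem at \<open>Q\<close> replaces it by a prime between its neighbours that contains
  \<open>x\<close>. Repeating this moves \<open>x\<close> down one link at a time; at the bottom
  \<open>P\<close> is dropped, which costs one link.\<close>

lemma prime_chain_push:
  assumes "prime_chain (Suc d) P Q" "x \<in> Q"
  shows "\<exists>P'. prime_chain d P' Q \<and> x \<in> P' \<and> P \<subset> P'"
  using assms
proof (induction d arbitrary: Q)
  case 0
  from 0(1) obtain P0 where "prime_chain 0 P P0" "cprime Q" "P0 \<subset> Q" "Q \<subseteq> M"
    by cases auto
  then have "prime_chain 0 Q Q" "P \<subset> Q"
    using prime_chainD[of 0 P P0] by (auto elim: prime_chain.cases intro!: prime_chain_0)
  then show ?case using 0 by blast
next
  case (Suc d)
  from Suc.prems(1) obtain Q1 where Q1: "prime_chain (Suc d) P Q1" "cprime Q" "Q1 \<subset> Q" "Q \<subseteq> M"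
    by cases auto
  show ?case
  proof (cases "x \<in> Q1")
    case True
    with Suc.IH[OF Q1(1)] obtain P' where "prime_chain d P' Q1" "x \<in> P'" "P \<subset> P'" by blast
    then show ?thesis using prime_chain_Suc Q1 by blast
  next
    case False
    from Q1(1) obtain Q2 where Q2: "prime_chain d P Q2" "cprime Q1" "Q2 \<subset> Q1"
      by cases auto
    \<comment> \<open>The segment to be modified ends at \<open>Q\<close>, not at \<open>M\<close>,
      so the theorem is applied in the localization at \<open>Q\<close>.\<close>
    interpret Q: local_noetherian Q I by (rule restrict) (use Q1 in auto)
    obtain Q' where Q': "cprime Q'" "Q2 \<subset> Q'" "Q' \<subset> Q" "x \<in> Q'"
      using Q.principal_ideal_theorem[of Q2 Q1 x] prime_chainD[OF Q2(1)] Q2 Q1 False Suc.prems by blast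
    then have "prime_chain (Suc d) P Q'" using prime_chain_Suc[OF Q2(1)] Q1 by blast
    from Suc.IH[OF this Q'(4)] obtain P' where "prime_chain d P' Q'" "x \<in> P'" "P \<subset> P'" by blast
    then show ?thesis using prime_chain_Suc Q1 Q' by blast
  qed
qed

abbreviation gens :: "'a set \<Rightarrow> 'a list \<Rightarrow> 'a set" where
  "gens \<equiv> foldl (adjoin M)"

lemma saturated_gens: "saturated M J \<Longrightarrow> saturated M (gens J xs)"
  by (induction xs arbitrary: J) (auto intro: saturated_adjoin prime_M saturated_cideal)

lemma gens_superset: "J \<subseteq> gens J xs"
proof (induction xs arbitrary: J)
  case (Cons x xs)
  then show ?case using adjoin_superset[OF prime_M, of J x] by force
qed auto

lemma in_gens: "saturated M J \<Longrightarrow> x \<in> set xs \<Longrightarrow> x \<in> gens J xs"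
proof (induction xs arbitrary: J)
  case (Cons y xs)
  then show ?case
    using gens_superset[of "adjoin M J y" xs] adjoin_self[OF prime_M, of J y] saturated_adjoin[OF prime_M, of J y]
    by (auto simp: saturated_cideal)
qed auto

lemma gens_least: "saturated M K \<Longrightarrow> J \<subseteq> K \<Longrightarrow> set xs \<subseteq> K \<Longrightarrow> gens J xs \<subseteq> K"
  by (induction xs arbitrary: J) (auto simp: adjoin_least)

lemma gens_Cons_M:
  assumes "saturated M J" "gens J (x # xs) = M"
  shows "x \<in> M" "saturated M (adjoin M J x)" "gens (adjoin M J x) xs = M"
  using assms in_gens[of J x "x # xs"] saturated_adjoin[OF prime_M, of J x] saturated_cideal by auto

text \<open>The dimension of a local ring is at most the number of generators of its maximal ideal:
  passing to the quotient by one generator shortens a chain by at most one link.\<close>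

lemma prime_chain_bound_M:
  "gens J xs = M \<Longrightarrow> saturated M J \<Longrightarrow> prime_chain d P M \<Longrightarrow> J \<subseteq> P \<Longrightarrow> d \<le> length xs"
proof (induction xs arbitrary: J d P)
  case Nil
  then have "P = M" using prime_chainD[of d P M] by auto
  then show ?case using prime_chainD[OF Nil(3)] by auto
next
  case (Cons x xs)
  note x = gens_Cons_M[OF Cons.prems(2,1)]
  show ?case
  proof (cases d)
    case (Suc e)
    then obtain P' where P': "prime_chain e P' M" "x \<in> P'" "P \<subset> P'"
      using prime_chain_push Cons.prems x by metis
    moreover have "saturated M P'" using prime_chainD[OF P'(1)] cprime_saturated by auto
    ultimately have "adjoin M J x \<subseteq> P'" using adjoin_least Cons.prems by blast
    then show ?thesis using Cons.IH[OF x(3,2) P'(1)] Suc by simp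
  qed simp
qed

text \<open>A chain of maximal length that stopped below \<open>M\<close> could be prolonged by
  \<open>M\<close>. This identifies the top of the chain that realizes the Krull dimension.\<close>

lemma prime_chain_top:
  assumes "gens J xs = M" "saturated M J" "prime_chain (length xs) P Q" "J \<subseteq> P"
  shows "Q = M"
proof (rule ccontr)
  assume "Q \<noteq> M"
  then have "prime_chain (Suc (length xs)) P M"
    using prime_chain_Suc[OF assms(3) prime_M] prime_chainD[OF assms(3)] by blast
  from prime_chain_bound_M[OF assms(1,2) this assms(4)] show False by simp
qed

text \<open>A regular local ring is a domain. By induction the ideal generated by \<open>J\<close>
  and the first parameter \<open>x\<close> is a prime containing \<open>P\<close>. Hence every
  element of \<open>P\<close> is, up to a unit, \<open>r * x\<close> modulo \<open>J\<close>, and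
  \<open>x\<close> outside \<open>P\<close> puts \<open>r\<close> into \<open>P\<close>. So
  \<open>P\<close> equals \<open>J\<close> plus \<open>x\<close> times \<open>P\<close>, and
  Nakayama's lemma removes the second summand.\<close>

lemma regular_prime:
  "gens J xs = M \<Longrightarrow> saturated M J \<Longrightarrow> I \<subseteq> J \<Longrightarrow> prime_chain (length xs) P M \<Longrightarrow> J \<subseteq> P \<Longrightarrow> J = P"
proof (induction xs arbitrary: J P)
  case Nil
  then show ?case using prime_chainD[of _ P M] by auto
next
  case (Cons x xs)
  note x = gens_Cons_M[OF Cons.prems(2,1)]
  obtain P' where P': "prime_chain (length xs) P' M" "x \<in> P'" "P \<subset> P'"
    using prime_chain_push Cons.prems x by fastforce
  note cP = prime_chainD[OF Cons.prems(4)]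
  have satP: "saturated M P" using cP cprime_saturated by auto
  have "saturated M P'" using prime_chainD[OF P'(1)] cprime_saturated by auto
  then have sub: "adjoin M J x \<subseteq> P'" using adjoin_least Cons.prems P' by blast
  have IJ: "I \<subseteq> adjoin M J x" using Cons.prems(3) adjoin_superset[OF prime_M] by blast
  have eq: "adjoin M J x = P'" by (rule Cons.IH[OF x(3,2) IJ P'(1) sub])
  \<comment> \<open>Otherwise the remaining parameters alone would generate \<open>M\<close> over an
    ideal inside \<open>P\<close>, and there are too few of them for the chain from \<open>P\<close>
    to \<open>M\<close>.\<close>
  have "x \<notin> P"
  proof
    assume "x \<in> P"
    then have "adjoin M J x \<subseteq> P" using adjoin_least[OF satP] Cons.prems by blast
    from prime_chain_bound_M[OF x(3,2) Cons.prems(4) this] show False by simp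
  qed
  have "P \<subseteq> J"
  proof (rule nakayama[OF satP Cons.prems(2,3,5) x(1)])
    fix a assume a: "a \<in> P"
    then obtain u r where ur: "u \<notin> M" "u * a - r * x \<in> J"
      using P'(3) unfolding eq[symmetric] adjoin_def by blast
    then have "x * r \<in> P"
      using cideal_diff_iff[OF saturated_cideal[OF satP], of "u * a" "r * x"] Cons.prems(5)
        cideal_mult[OF saturated_cideal[OF satP] a] by (metis mult.commute subsetD)
    then have "r \<in> P" using cprime_mult cP \<open>x \<notin> P\<close> by blast
    then show "\<exists>u r. u \<notin> M \<and> r \<in> P \<and> u * a - r * x \<in> J" using ur by blast
  qed
  then show ?case using Cons.prems by blast
qed

text \<open>The inductive step along the parameters: the quotient by a parameter is again regular,
  of dimension one less, and the parameter is nonzero before the quotient is taken.\<close>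

lemma regular_Cons:
  assumes "gens J (x # xs) = M" "saturated M J" "I \<subseteq> J" "prime_chain (length (x # xs)) P M" "J \<subseteq> P"
  shows "x \<notin> J" "x \<in> M" "cprime (adjoin M J x)" "gens (adjoin M J x) xs = M" "saturated M (adjoin M J x)"
    "I \<subseteq> adjoin M J x" "prime_chain (length xs) (adjoin M J x) M"
proof -
  note x = gens_Cons_M[OF assms(2,1)]
  have JP: "J = P" by (rule regular_prime[OF assms])
  obtain P' where P': "prime_chain (length xs) P' M" "x \<in> P'" "P \<subset> P'"
    using prime_chain_push assms x by fastforce
  have satP': "saturated M P'" using prime_chainD[OF P'(1)] cprime_saturated by auto
  then have sub: "adjoin M J x \<subseteq> P'" using adjoin_least assms P' by blast
  show "I \<subseteq> adjoin M J x" using assms(3) adjoin_superset[OF prime_M] by blast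
  then have eq: "adjoin M J x = P'" by (rule regular_prime[OF x(3,2) _ P'(1) sub])
  then show "cprime (adjoin M J x)" "prime_chain (length xs) (adjoin M J x) M"
    using P'(1) prime_chainD by auto
  show "x \<notin> J"
    using adjoin_least[OF assms(2) order_refl] P'(3) JP eq by blast
qed (use gens_Cons_M[OF assms(2,1)] in auto)

section \<open>Anisotropic diagonal forms\<close>

text \<open>With \<open>P = K\<close> prime this is anisotropy over the fraction field of the
  quotient by \<open>P\<close>. Two ideals are needed for the intermediate statement that a zero
  modulo \<open>P\<close> has all its coordinates divisible by the next parameter modulo
  \<open>P\<close>.\<close>

definition anisotropic :: "nat \<Rightarrow> nat set \<Rightarrow> (nat \<Rightarrow> 'a) \<Rightarrow> 'a set \<Rightarrow> 'a set \<Rightarrow> bool" where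
  "anisotropic n A c P K \<longleftrightarrow> (\<forall>h. (\<Sum>i\<in>A. c i * h i ^ n) \<in> P \<longrightarrow> (\<forall>i\<in>A. h i \<in> K))"

text \<open>Among the nontrivial zeros choose one whose coordinates generate a maximal ideal; dividing
  it by \<open>t\<close> does not enlarge that ideal, which contradicts Nakayama's lemma.\<close>

lemma anisotropic_lift:
  assumes P: "cprime P" "I \<subseteq> P" "P \<subseteq> M" and t: "t \<in> M" "t \<notin> P" and A: "finite A"
    and an: "anisotropic n A c P (adjoin M P t)"
  shows "anisotropic n A c P P"
proof (rule ccontr)
  assume not: "\<not> ?thesis"
  note idP = cprime_cideal[OF P(1)]
  define ok where "ok h \<longleftrightarrow> (\<Sum>i\<in>A. c i * h i ^ n) \<in> P" for h
  \<comment> \<open>The ideal generated by \<open>P\<close> and the coordinates in the localization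
    at \<open>M\<close>.\<close>
  define span_of where "span_of h = \<Inter>{K. saturated M K \<and> P \<subseteq> K \<and> h ` A \<subseteq> K}" for h
  have sat: "saturated M (span_of h)" for h
    unfolding span_of_def by (rule saturated_Inter) auto
  have Ph: "P \<subseteq> span_of h" and in_span_of: "i \<in> A \<Longrightarrow> h i \<in> span_of h" for h i
    unfolding span_of_def by auto
  have span_of_least: "saturated M K \<Longrightarrow> P \<subseteq> K \<Longrightarrow> h ` A \<subseteq> K \<Longrightarrow> span_of h \<subseteq> K" for h K
    unfolding span_of_def by blast
  define C where "C = span_of ` {h. ok h \<and> \<not> h ` A \<subseteq> P}"
  obtain h0 where "span_of h0 \<in> C" using not by (auto simp: C_def anisotropic_def ok_def)
  then have "\<exists>J\<in>C. \<forall>K\<in>C. J \<subseteq> K \<longrightarrow> K = J"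
    by (rule maximal_exists) (use sat Ph P in \<open>auto simp: C_def\<close>)
  then obtain J where J: "J \<in> C" and max_J: "\<And>K. K \<in> C \<Longrightarrow> J \<subseteq> K \<Longrightarrow> K = J" by blast
  from J obtain h where h: "ok h" "\<not> h ` A \<subseteq> P" and Jh: "J = span_of h" by (auto simp: C_def)
  have max: "span_of k = span_of h" if "ok k" "\<not> k ` A \<subseteq> P" "span_of h \<subseteq> span_of k" for k
    using max_J[of "span_of k"] that unfolding Jh by (simp add: C_def)
  have "\<forall>i\<in>A. \<exists>u r. u \<notin> M \<and> u * h i - r * t \<in> P"
    using an h(1) unfolding anisotropic_def ok_def adjoin_def by blast
  then have "\<exists>u. \<forall>i\<in>A. \<exists>r. u i \<notin> M \<and> u i * h i - r * t \<in> P" by (rule bchoice)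
  then obtain u where u: "\<forall>i\<in>A. \<exists>r. u i \<notin> M \<and> u i * h i - r * t \<in> P" ..
  from bchoice[OF u] obtain r where "\<forall>i\<in>A. u i \<notin> M \<and> u i * h i - r i * t \<in> P" ..
  then have ur: "\<And>i. i \<in> A \<Longrightarrow> u i \<notin> M" "\<And>i. i \<in> A \<Longrightarrow> u i * h i - r i * t \<in> P" by auto
  \<comment> \<open>The product of the denominators, so that \<open>k i\<close> is
    \<open>v * h i\<close> divided by \<open>t\<close> modulo \<open>P\<close>, with one unit
    \<open>v\<close> for all coordinates. By homogeneity \<open>k\<close> is again a zero once
    \<open>t ^ n\<close> is cancelled.\<close>
  define v where "v = prod u A"
  define k where "k i = prod u (A - {i}) * r i" for i
  have vM: "v \<notin> M" unfolding v_def using cprime_prod[OF prime_M] ur(1) by blast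
  have vk: "v * h i - k i * t \<in> P" if "i \<in> A" for i
  proof -
    have "v * h i - k i * t = prod u (A - {i}) * (u i * h i - r i * t)"
      unfolding v_def k_def prod.remove[OF A that] by (simp add: algebra_simps)
    then show ?thesis using cideal_mult[OF idP ur(2)[OF that]] by simp
  qed
  have pow: "x ^ m - y ^ m \<in> P" if "x - y \<in> P" for x y m
    using cideal_mult2[OF idP that] by (simp add: power_diff_sumr2)
  have "v ^ n * (\<Sum>i\<in>A. c i * h i ^ n) - t ^ n * (\<Sum>i\<in>A. c i * k i ^ n)
      = (\<Sum>i\<in>A. c i * ((v * h i) ^ n - (k i * t) ^ n))"
    by (simp add: sum_distrib_left sum_subtractf power_mult_distrib algebra_simps)
  also have "\<dots> \<in> P" by (intro cideal_sum[OF idP] cideal_mult[OF idP] pow vk)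
  finally have "t ^ n * (\<Sum>i\<in>A. c i * k i ^ n) \<in> P"
    using cideal_diff_iff[OF idP] cideal_mult[OF idP h(1)[unfolded ok_def]] by blast
  then have "ok k" unfolding ok_def using cprime_mult[OF P(1)] cprime_power[OF P(1)] t by blast
  have vP: "v \<notin> P" using vM P by blast
  have "\<not> k ` A \<subseteq> P"
  proof
    assume k: "k ` A \<subseteq> P"
    have "h i \<in> P" if "i \<in> A" for i
    proof -
      have "k i * t \<in> P" using cideal_mult2[OF idP, of "k i"] k that by blast
      then have "v * h i \<in> P" using cideal_diff_iff[OF idP vk[OF that]] by blast
      then show ?thesis using cprime_mult[OF P(1)] vP by blast
    qed
    then show False using h by blast
  qed
  note idh = saturated_cideal[OF sat]
  have "span_of h \<subseteq> span_of k"
  proof (rule span_of_least[OF sat Ph], safe)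
    fix i assume i: "i \<in> A"
    have "v * h i \<in> span_of k"
      using cideal_diff_iff[OF idh, of "v * h i" "k i * t" k] vk[OF i] Ph
        cideal_mult2[OF idh in_span_of[OF i], of _ t] by blast
    then show "h i \<in> span_of k" using saturatedD[OF sat vM] by blast
  qed
  then have eq: "span_of k = span_of h" using max \<open>ok k\<close> \<open>\<not> k ` A \<subseteq> P\<close> by blast
  have "span_of h \<subseteq> P"
  proof (rule nakayama[OF sat cprime_saturated[OF P(1,3)] P(2) Ph t(1)])
    \<comment> \<open>\<open>L\<close> represents \<open>P\<close> plus \<open>t\<close> times
      \<open>span_of h\<close>. It contains the coordinates of \<open>h\<close>, because those of
      \<open>k\<close> lie in \<open>span_of k\<close>, which equals \<open>span_of h\<close> by
      maximality; this is the hypothesis of Nakayama's lemma.\<close>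
    define L where "L = {a. \<exists>u r. u \<notin> M \<and> r \<in> span_of h \<and> u * a - r * t \<in> P}"
    have LI: "a \<in> L" if "u \<notin> M" "r \<in> span_of h" "u * a - r * t \<in> P" for a u r
      unfolding L_def using that by blast
    have "saturated M L"
      unfolding saturated_def cideal_def
    proof (intro conjI allI ballI impI)
      show "0 \<in> L"
        using LI[of 1 0] cprime_one[OF prime_M] cideal_zero[OF idh] cideal_zero[OF idP] by simp
      fix a b q assume "a \<in> L"
      then obtain u s where a: "u \<notin> M" "s \<in> span_of h" "u * a - s * t \<in> P" unfolding L_def by blast
      have "u * (q * a) - (q * s) * t = q * (u * a - s * t)" by (simp add: algebra_simps)
      then have "u * (q * a) - (q * s) * t \<in> P" using cideal_mult[OF idP a(3)] by simp
      then show "q * a \<in> L" using a cideal_mult[OF idh a(2)] unfolding L_def by blast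
      assume "b \<in> L"
      then obtain w z where b: "w \<notin> M" "z \<in> span_of h" "w * b - z * t \<in> P" unfolding L_def by blast
      have "(u * w) * (a + b) - (w * s + u * z) * t = w * (u * a - s * t) + u * (w * b - z * t)"
        by (simp add: algebra_simps)
      then have "(u * w) * (a + b) - (w * s + u * z) * t \<in> P"
        using a b by (simp add: cideal_add[OF idP] cideal_mult[OF idP])
      moreover have "u * w \<notin> M" using cprime_mult[OF prime_M] a b by blast
      moreover have "w * s + u * z \<in> span_of h"
        using a b by (intro cideal_add[OF idh] cideal_mult[OF idh])
      ultimately show "a + b \<in> L" unfolding L_def by blast
    next
      fix w a assume w: "w \<notin> M" and "w * a \<in> L"
      then obtain u s where a: "u \<notin> M" "s \<in> span_of h" "u * (w * a) - s * t \<in> P" unfolding L_def by blast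
      then have "u * w \<notin> M" "(u * w) * a - s * t \<in> P"
        using w cprime_mult[OF prime_M] by (auto simp: mult.assoc)
      then show "a \<in> L" using a unfolding L_def by blast
    qed
    moreover have "P \<subseteq> L"
      using LI[of 1 0] cprime_one[OF prime_M] cideal_zero[OF idh] by auto
    moreover have "h ` A \<subseteq> L"
      using LI[OF vM _ vk] in_span_of[of _ k] eq by blast
    ultimately have "span_of h \<subseteq> L" by (rule span_of_least)
    then show "a \<in> span_of h \<Longrightarrow> \<exists>u r. u \<notin> M \<and> r \<in> span_of h \<and> u * a - r * t \<in> P" for a
      unfolding L_def by blast
  qed
  then show False using in_span_of h by blast
qed

lemma anisotropic_regular:
  assumes "finite A" "anisotropic n A c M M"
  shows "gens J xs = M \<Longrightarrow> saturated M J \<Longrightarrow> I \<subseteq> J \<Longrightarrow> prime_chain (length xs) P M \<Longrightarrow> J \<subseteq> P \<Longrightarrow>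
    anisotropic n A c J J"
proof (induction xs arbitrary: J P)
  case Nil
  then show ?case using assms by simp
next
  case (Cons x xs)
  note x = regular_Cons[OF Cons.prems]
  have J: "cprime J" "J \<subseteq> M"
    using regular_prime[OF Cons.prems] prime_chainD[OF Cons.prems(4)] by auto
  have "anisotropic n A c (adjoin M J x) (adjoin M J x)"
    by (rule Cons.IH[OF x(4,5,6,7) order_refl])
  \<comment> \<open>A zero modulo \<open>J\<close> is also one modulo the larger ideal, which yields
    the mixed form that the lifting step takes.\<close>
  then have "anisotropic n A c J (adjoin M J x)"
    using adjoin_superset[OF prime_M, of J x] unfolding anisotropic_def by blast
  then show ?case
    by (rule anisotropic_lift[OF J(1) Cons.prems(3) J(2) x(2,1) assms(1)])
qed

text \<open>If the form vanishes at \<open>h\<close>, then \<open>t\<close> divides \<open>h\<^sub>0, \<dots>, h\<^bsub>s-1\<^esub>\<close>, so \<open>t\<^sup>2\<close> divides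
  \<open>t w h\<^sub>s\<^sup>m\<close> and hence \<open>t\<close> divides \<open>h\<^sub>s\<close>.\<close>

lemma anisotropic_uniformizer:
  fixes s :: nat and t w :: 'a
  defines "c \<equiv> (\<lambda>i. if i < s then 1 else - (t * w))"
  assumes I: "cprime I" "I \<subseteq> M"
    and t: "gens I (t # ts) = M" "prime_chain (length (t # ts)) P M"
    and an: "anisotropic m {..<s} (\<lambda>_. 1) M M" and m: "1 < m" and w: "w \<notin> M"
  shows "anisotropic m {..s} c I I"
proof -
  have satI: "saturated M I" by (rule cprime_saturated[OF I])
  note idI = cprime_cideal[OF I(1)]
  have "I \<subseteq> P" using prime_chainD[OF t(2)] by blast
  note t' = regular_Cons[OF t(1) satI order_refl t(2) this]
  define N where "N = adjoin M I t"
  \<comment> \<open>Membership in \<open>N2\<close> stands for order at least two, so no valuation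
    has to be introduced.\<close>
  define N2 where "N2 = adjoin M I (t ^ 2)"
  have N: "cprime N" "saturated M N" "I \<subseteq> N" "t \<in> N" "N \<subseteq> M"
    unfolding N_def using t' adjoin_self[OF prime_M idI] prime_chainD by blast+
  note idN = cprime_cideal[OF N(1)]
  have N2: "cideal N2" "I \<subseteq> N2"
    unfolding N2_def using saturated_adjoin[OF prime_M idI] saturated_cideal adjoin_superset[OF prime_M] by blast+
  have pow_N2: "a ^ m \<in> N2" if a: "a \<in> N" for a
  proof -
    obtain u r where ur: "u \<notin> M" "u * a - r * t \<in> I" using a unfolding N_def adjoin_def by blast
    \<comment> \<open>Here \<open>1 < m\<close> enters: the m-th power of a multiple of
      \<open>t\<close> is a multiple of \<open>t ^ 2\<close>.\<close>
    have "m = m - 2 + 2" using m by simp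
    then have "t ^ m = t ^ (m - 2) * t ^ 2" by (metis power_add)
    then have "u ^ m * a ^ m - (r ^ m * t ^ (m - 2)) * t ^ 2 = (u * a) ^ m - (r * t) ^ m"
      by (simp add: power_mult_distrib mult.assoc)
    also have "\<dots> \<in> I" using cideal_mult2[OF idI ur(2)] by (simp add: power_diff_sumr2)
    finally have "u ^ m * a ^ m - (r ^ m * t ^ (m - 2)) * t ^ 2 \<in> I" .
    then show ?thesis
      unfolding N2_def by (rule adjoinI[rotated]) (use cprime_power[OF prime_M] ur(1) in blast)
  qed
  have "anisotropic m {..<s} (\<lambda>_. 1) N N"
    unfolding N_def
    by (rule anisotropic_regular[OF _ an t'(4,5,6,7) order_refl]) simp
  have "h i \<in> N" if h: "(\<Sum>i\<le>s. c i * h i ^ m) \<in> I" and i: "i \<le> s" for h i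
  proof -
    note h
    moreover have "{..s} = insert s {..<s}" by auto
    ultimately have "(\<Sum>i<s. c i * h i ^ m) + c s * h s ^ m \<in> I" by (simp add: add.commute)
    moreover have "(\<Sum>i<s. c i * h i ^ m) = (\<Sum>i<s. h i ^ m)" by (rule sum.cong) (auto simp: c_def)
    ultimately have eq: "(\<Sum>i<s. h i ^ m) - t * w * h s ^ m \<in> I" by (simp add: c_def)
    then have "(\<Sum>i<s. h i ^ m) - t * w * h s ^ m \<in> N" using N by blast
    moreover have "t * w * h s ^ m \<in> N" using cideal_mult2[OF idN N(4)] by (simp add: mult.assoc)
    ultimately have "(\<Sum>i<s. h i ^ m) \<in> N" using cideal_diff_iff[OF idN] by blast
    then have hi: "h i \<in> N" if "i < s" for i
      using \<open>anisotropic m {..<s} (\<lambda>_. 1) N N\<close> that unfolding anisotropic_def by auto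
    then have "(\<Sum>i<s. h i ^ m) \<in> N2" by (intro cideal_sum[OF N2(1)] pow_N2) auto
    then have "t * w * h s ^ m \<in> N2" using cideal_diff_iff[OF N2(1)] eq N2(2) by blast
    then obtain u r where u: "u \<notin> M" "u * (t * w * h s ^ m) - r * t ^ 2 \<in> I"
      unfolding N2_def adjoin_def by blast
    \<comment> \<open>One factor \<open>t\<close> is cancelled modulo the prime \<open>I\<close>,
      which does not contain \<open>t\<close>; since \<open>u * w\<close> is a unit at
      \<open>M\<close>, what remains says that \<open>t\<close> divides
      \<open>h s ^ m\<close>.\<close>
    have "u * (t * w * h s ^ m) - r * t ^ 2 = t * ((u * w) * h s ^ m - r * t)"
      by (simp add: algebra_simps power2_eq_square)
    then have "(u * w) * h s ^ m - r * t \<in> I"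
      using u(2) cprime_mult[OF I(1)] t'(1) by metis
    moreover have "u * w \<notin> M" using cprime_mult[OF prime_M] u(1) w by blast
    ultimately have "h s ^ m \<in> N" unfolding N_def by (rule adjoinI[rotated])
    then have "h s \<in> N" using cprime_power[OF N(1)] by blast
    then show "h i \<in> N" using hi i by (cases "i = s") auto
  qed
  then have "anisotropic m {..s} c I N" unfolding anisotropic_def by blast
  then show ?thesis
    unfolding N_def by (intro anisotropic_lift[OF I(1) order_refl I(2) t'(2,1)]) auto
qed

end


section \<open>Fractions\<close>

text \<open>\<open>R\<close> is the ring of fractions with denominators in \<open>T\<close> of the image of \<open>\<phi>\<close>, which is the
  ambient ring modulo the prime ideal \<open>I\<close>.\<close>

locale fraction_hom = cring R for R :: "('b, 'c) ring_scheme" (structure) +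
  fixes \<phi> :: "'a::comm_ring_1 \<Rightarrow> 'b" and I T :: "'a set"
  assumes hom_closed [simp]: "\<phi> a \<in> carrier R"
    and hom_add: "\<phi> (a + b) = \<phi> a \<oplus> \<phi> b"
    and hom_mult: "\<phi> (a * b) = \<phi> a \<otimes> \<phi> b"
    and hom_one [simp]: "\<phi> 1 = \<one>"
    and hom_ker: "\<phi> a = \<zero> \<longleftrightarrow> a \<in> I"
    and prime_ker: "cprime I"
    and one_denom: "1 \<in> T"
    and mult_denom: "s \<in> T \<Longrightarrow> t \<in> T \<Longrightarrow> s * t \<in> T"
    and denom_unit: "t \<in> T \<Longrightarrow> \<phi> t \<in> Units R"
    and denom_notin: "t \<in> T \<Longrightarrow> t \<notin> I"
    and denominator: "y \<in> carrier R \<Longrightarrow> \<exists>t\<in>T. \<exists>a. \<phi> t \<otimes> y = \<phi> a"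
begin

lemma ideal_ker: "cideal I"
  using prime_ker by (rule cprime_cideal)

lemma zero_in_ker: "0 \<in> I"
  using ideal_ker by (rule cideal_zero)

lemma hom_zero [simp]: "\<phi> 0 = \<zero>"
  using hom_ker zero_in_ker by blast

lemma hom_uminus: "\<phi> (- a) = \<ominus> \<phi> a"
proof -
  have "\<phi> (- a) \<oplus> \<phi> a = \<zero>" by (simp flip: hom_add)
  then show ?thesis using minus_equality[of "\<phi> (- a)" "\<phi> a"] by simp
qed

lemma hom_diff: "\<phi> (a - b) = \<phi> a \<ominus> \<phi> b"
  using hom_add[of a "- b"] by (simp add: hom_uminus a_minus_def)

lemma hom_eq_iff: "\<phi> a = \<phi> b \<longleftrightarrow> a - b \<in> I"
  using hom_ker[of "a - b"] by (simp add: hom_diff)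

lemma hom_power: "\<phi> (a ^ n) = \<phi> a [^] n"
proof (induction n)
  case (Suc n)
  have "\<phi> (a ^ Suc n) = \<phi> (a ^ n) \<otimes> \<phi> a" by (simp flip: hom_mult add: mult.commute)
  then show ?case using Suc by simp
qed simp

lemma hom_sum: "\<phi> (sum f A) = (\<Oplus>i\<in>A. \<phi> (f i))"
  by (induction A rule: infinite_finite_induct) (simp_all add: hom_add)

lemma power_denom: "t \<in> T \<Longrightarrow> t ^ n \<in> T"
  by (induction n) (auto simp: one_denom mult_denom)

lemma prod_denom: "(\<And>i. i \<in> A \<Longrightarrow> f i \<in> T) \<Longrightarrow> prod f A \<in> T"
  by (induction A rule: infinite_finite_induct) (auto simp: one_denom mult_denom)

lemma denom_cancel: "t \<in> T \<Longrightarrow> x \<in> carrier R \<Longrightarrow> y \<in> carrier R \<Longrightarrow>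
    \<phi> t \<otimes> x = \<phi> t \<otimes> y \<Longrightarrow> x = y"
  using Units_l_cancel[OF denom_unit, of t x y] by simp

lemma common_denominator:
  assumes "finite A" "\<And>i. i \<in> A \<Longrightarrow> f i \<in> carrier R"
  shows "\<exists>u\<in>T. \<exists>b. \<forall>i\<in>A. \<phi> u \<otimes> f i = \<phi> (b i)"
proof -
  have "\<forall>i\<in>A. \<exists>t. t \<in> T \<and> (\<exists>a. \<phi> t \<otimes> f i = \<phi> a)" using denominator assms by blast
  from bchoice[OF this] obtain t where t: "\<And>i. i \<in> A \<Longrightarrow> t i \<in> T"
    and "\<forall>i\<in>A. \<exists>a. \<phi> (t i) \<otimes> f i = \<phi> a" by blast
  from bchoice[OF this(2)] obtain a where a: "\<And>i. i \<in> A \<Longrightarrow> \<phi> (t i) \<otimes> f i = \<phi> (a i)" by blast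
  have "\<phi> (prod t A) \<otimes> f i = \<phi> (prod t (A - {i}) * a i)" if i: "i \<in> A" for i
  proof -
    have "prod t A = prod t (A - {i}) * t i"
      by (simp add: prod.remove[OF assms(1) i] mult.commute)
    then show ?thesis using a[OF i] assms(2)[OF i] by (simp add: hom_mult m_assoc)
  qed
  moreover have "prod t A \<in> T" using t by (rule prod_denom)
  ultimately show ?thesis by (intro bexI[of _ "prod t A"] exI[of _ "\<lambda>i. prod t (A - {i}) * a i"]) auto
qed

lemma finsum_power_mult:
  assumes "finite A" "x \<in> carrier R" "\<And>i. i \<in> A \<Longrightarrow> f i \<in> carrier R"
  shows "x [^] n \<otimes> (\<Oplus>i\<in>A. f i [^] n) = (\<Oplus>i\<in>A. (x \<otimes> f i) [^] (n::nat))"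
proof -
  have "x [^] n \<otimes> (\<Oplus>i\<in>A. f i [^] n) = (\<Oplus>i\<in>A. x [^] n \<otimes> f i [^] n)"
    by (rule finsum_rdistr) (use assms in auto)
  also have "\<dots> = (\<Oplus>i\<in>A. (x \<otimes> f i) [^] n)"
    by (rule finsum_cong') (use assms in \<open>auto simp: nat_pow_distrib\<close>)
  finally show ?thesis .
qed

text \<open>Clearing a common denominator turns sums of powers in \<open>R\<close> into congruences
  modulo \<open>I\<close> in the ambient ring. All comparisons between k[V], k(V) and k go through
  this.\<close>

lemma sum_of_powers_iff:
  assumes y: "y \<in> carrier R"
  shows "sum_of_powers R n g y \<longleftrightarrow> (\<exists>u\<in>T. \<exists>c. \<phi> (u ^ n) \<otimes> y = \<phi> (\<Sum>i<g. c i ^ n))"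
proof
  assume "sum_of_powers R n g y"
  then obtain f where f: "\<And>i. i < g \<Longrightarrow> f i \<in> carrier R" "y = (\<Oplus>i\<in>{..<g}. f i [^] n)"
    unfolding sum_of_powers_def by blast
  then obtain u b where ub: "u \<in> T" "\<And>i. i < g \<Longrightarrow> \<phi> u \<otimes> f i = \<phi> (b i)"
    using common_denominator[of "{..<g}" f] by auto
  have "\<phi> (u ^ n) \<otimes> y = (\<Oplus>i\<in>{..<g}. (\<phi> u \<otimes> f i) [^] n)"
    unfolding f(2) hom_power by (rule finsum_power_mult) (use f in auto)
  also have "\<dots> = (\<Oplus>i\<in>{..<g}. \<phi> (b i ^ n))"
    by (rule finsum_cong') (use ub in \<open>auto simp: hom_power\<close>)
  finally show "\<exists>u\<in>T. \<exists>c. \<phi> (u ^ n) \<otimes> y = \<phi> (\<Sum>i<g. c i ^ n)"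
    using ub(1) by (auto simp: hom_sum)
next
  assume "\<exists>u\<in>T. \<exists>c. \<phi> (u ^ n) \<otimes> y = \<phi> (\<Sum>i<g. c i ^ n)"
  then obtain u c where u: "u \<in> T" and c: "\<phi> (u ^ n) \<otimes> y = \<phi> (\<Sum>i<g. c i ^ n)" by blast
  define f where "f i = inv (\<phi> u) \<otimes> \<phi> (c i)" for i
  have inv: "inv (\<phi> u) \<in> carrier R" "\<phi> u \<otimes> inv (\<phi> u) = \<one>" using denom_unit[OF u] by auto
  have f: "f i \<in> carrier R" "\<phi> u \<otimes> f i = \<phi> (c i)" for i
    using inv unfolding f_def by (auto simp flip: m_assoc)
  have "\<phi> (u ^ n) \<otimes> (\<Oplus>i\<in>{..<g}. f i [^] n) = (\<Oplus>i\<in>{..<g}. (\<phi> u \<otimes> f i) [^] n)"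
    unfolding hom_power by (rule finsum_power_mult) (use f in auto)
  also have "\<dots> = \<phi> (u ^ n) \<otimes> y" unfolding c by (simp add: f hom_sum hom_power)
  finally have "y = (\<Oplus>i\<in>{..<g}. f i [^] n)"
    using denom_cancel[OF power_denom[OF u], of y _ n] y f by (auto simp: Pi_def)
  then show "sum_of_powers R n g y"
    unfolding sum_of_powers_def using f(1) by (intro exI[of _ f]) simp
qed

lemma sum_of_powers_hom_iff:
  "sum_of_powers R n g (\<phi> p) \<longleftrightarrow> (\<exists>u\<in>T. \<exists>c. u ^ n * p - (\<Sum>i<g. c i ^ n) \<in> I)"
  by (simp add: sum_of_powers_iff hom_eq_iff flip: hom_mult)

end

section \<open>Localizations of a quotient ring\<close>

text \<open>With the single denominator 1 the map is onto, so fractions of \<open>R\<close> can be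
  computed with representatives in the ambient ring; \<open>T\<close> holds representatives of the
  new denominators.\<close>

locale surjective_hom = fraction_hom R \<phi> I "{1}"
  for R :: "('b, 'c) ring_scheme" (structure) and \<phi> :: "'a::comm_ring_1 \<Rightarrow> 'b" and I +
  fixes T
  assumes T_one: "1 \<in> T" and T_mult: "s \<in> T \<Longrightarrow> t \<in> T \<Longrightarrow> s * t \<in> T"
    and T_ker: "t \<in> T \<Longrightarrow> t \<notin> I"
begin

lemma surj: "y \<in> carrier R \<Longrightarrow> \<exists>a. y = \<phi> a"
  using denominator[of y] by simp

definition frac :: "'a \<Rightarrow> 'a \<Rightarrow> ('b \<times> 'b) set" where
  "frac a s = fraction R (\<phi> ` T) (\<phi> a) (\<phi> s)"

text \<open>The factor \<open>u\<close> in \<open>fraction_rel\<close> can be cancelled, because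
  \<open>I\<close> is prime and \<open>T\<close> avoids it.\<close>

lemma frac_eq_Collect:
  assumes s: "s \<in> T"
  shows "frac a s = {(\<phi> b, \<phi> t) | b t. t \<in> T \<and> a * t - b * s \<in> I}"
proof -
  have "(\<exists>u\<in>\<phi> ` T. u \<otimes> (\<phi> a \<otimes> \<phi> t \<ominus> \<phi> b \<otimes> \<phi> s) = \<zero>) \<longleftrightarrow> a * t - b * s \<in> I" for b t
  proof -
    have "(\<exists>u\<in>\<phi> ` T. u \<otimes> (\<phi> a \<otimes> \<phi> t \<ominus> \<phi> b \<otimes> \<phi> s) = \<zero>) \<longleftrightarrow> (\<exists>u\<in>T. u * (a * t - b * s) \<in> I)"
      by (auto simp: hom_ker simp flip: hom_mult hom_diff)
    also have "\<dots> \<longleftrightarrow> a * t - b * s \<in> I"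
      using cprime_mult[OF prime_ker] T_ker T_one cideal_mult[OF ideal_ker] by blast
    finally show ?thesis .
  qed
  then show ?thesis
    using s surj unfolding frac_def fraction_def fraction_rel_def by (auto simp: Image_def) metis
qed

lemma frac_mem: "s \<in> T \<Longrightarrow> (\<phi> a, \<phi> s) \<in> frac a s"
  using cideal_zero[OF ideal_ker] unfolding frac_eq_Collect mem_Collect_eq
  by (intro exI[of _ a] exI[of _ s]) simp

lemma frac_cross:
  assumes "s \<in> T" "t \<in> T" "a * t - b * s \<in> I"
  shows "a * w - c * s \<in> I \<longleftrightarrow> b * w - c * t \<in> I"
proof -
  have "t * (a * w - c * s) - s * (b * w - c * t) = w * (a * t - b * s)" by (simp add: algebra_simps)
  then have "t * (a * w - c * s) - s * (b * w - c * t) \<in> I"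
    using cideal_mult[OF ideal_ker assms(3)] by simp
  then have "t * (a * w - c * s) \<in> I \<longleftrightarrow> s * (b * w - c * t) \<in> I"
    by (rule cideal_diff_iff[OF ideal_ker])
  then show ?thesis
    using cprime_mult[OF prime_ker] cideal_mult[OF ideal_ker] T_ker assms by metis
qed

lemma frac_eq_iff:
  assumes "s \<in> T" "t \<in> T"
  shows "frac a s = frac b t \<longleftrightarrow> a * t - b * s \<in> I"
proof
  assume "frac a s = frac b t"
  then have "(\<phi> b, \<phi> t) \<in> frac a s" using frac_mem assms by simp
  then obtain b' t' where bt: "\<phi> b = \<phi> b'" "\<phi> t = \<phi> t'" "a * t' - b' * s \<in> I"
    using assms by (auto simp: frac_eq_Collect)
  have "(a * t - b * s) - (a * t' - b' * s) = a * (t - t') - s * (b - b')"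
    by (simp add: algebra_simps)
  also have "\<dots> \<in> I"
    using bt(1,2)[unfolded hom_eq_iff]
    by (rule cideal_diff[OF ideal_ker cideal_mult[OF ideal_ker] cideal_mult[OF ideal_ker], rotated])
  finally show "a * t - b * s \<in> I" using cideal_diff_iff[OF ideal_ker] bt(3) by blast
next
  assume "a * t - b * s \<in> I"
  from frac_cross[OF assms this] show "frac a s = frac b t"
    using assms by (simp add: frac_eq_Collect)
qed

lemma frac_memD:
  assumes "x \<in> frac a s" "s \<in> T"
  shows "\<exists>b t. x = (\<phi> b, \<phi> t) \<and> t \<in> T \<and> frac b t = frac a s"
proof -
  obtain b t where bt: "x = (\<phi> b, \<phi> t)" "t \<in> T" "a * t - b * s \<in> I"
    using assms by (auto simp: frac_eq_Collect)
  then have "frac a s = frac b t" using assms(2) by (simp add: frac_eq_iff)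
  then show ?thesis using bt by blast
qed

abbreviation "L \<equiv> localization R (\<phi> ` T)"

lemma carrier_localization: "carrier L = {frac a s | a s. s \<in> T}"
proof -
  have "carrier L = (\<Union>x\<in>carrier R \<times> \<phi> ` T. {fraction_rel R (\<phi> ` T) `` {x}})"
    by (simp add: localization_def quotient_def)
  also have "\<dots> = {frac a s | a s. s \<in> T}"
  proof -
    have "carrier R = range \<phi>" using surj by auto
    moreover have "(\<Union>x\<in>range \<phi> \<times> \<phi> ` T. {g x}) = {g (\<phi> a, \<phi> s) | a s. s \<in> T}"
      for g :: "'b \<times> 'b \<Rightarrow> ('b \<times> 'b) set" by auto
    ultimately show ?thesis unfolding frac_def fraction_def by simp
  qed
  finally show ?thesis .
qed

text \<open>Different representatives give the same product, so the union in the definition of the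
  multiplication collapses to one class.\<close>

lemma frac_mult:
  assumes s: "s \<in> T" and t: "t \<in> T"
  shows "frac a s \<otimes>\<^bsub>L\<^esub> frac b t = frac (a * b) (s * t)"
proof -
  have "fraction R (\<phi> ` T) (fst x \<otimes> fst y) (snd x \<otimes> snd y) = frac (a * b) (s * t)"
    if xy: "x \<in> frac a s" "y \<in> frac b t" for x y
  proof -
    obtain a' s' where x: "x = (\<phi> a', \<phi> s')" "s' \<in> T" "frac a' s' = frac a s"
      using frac_memD[OF xy(1) s] by blast
    obtain b' t' where y: "y = (\<phi> b', \<phi> t')" "t' \<in> T" "frac b' t' = frac b t"
      using frac_memD[OF xy(2) t] by blast
    have "a' * s - a * s' \<in> I" "b' * t - b * t' \<in> I"
      using x y s t by (auto simp: frac_eq_iff)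
    then have "(b' * t) * (a' * s - a * s') + (a * s') * (b' * t - b * t') \<in> I"
      by (intro cideal_add cideal_mult ideal_ker)
    then have "(a' * b') * (s * t) - (a * b) * (s' * t') \<in> I" by (simp add: algebra_simps)
    then have "frac (a' * b') (s' * t') = frac (a * b) (s * t)"
      using frac_eq_iff T_mult x y s t by simp
    then show ?thesis by (simp add: x y frac_def hom_mult)
  qed
  then show ?thesis
    using frac_mem[OF s, of a] frac_mem[OF t, of b] by (auto simp: localization_def)
qed

lemma frac_add:
  assumes s: "s \<in> T" and t: "t \<in> T"
  shows "frac a s \<oplus>\<^bsub>L\<^esub> frac b t = frac (a * t + b * s) (s * t)"
proof -
  have "fraction R (\<phi> ` T) (fst x \<otimes> snd y \<oplus> fst y \<otimes> snd x) (snd x \<otimes> snd y)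
      = frac (a * t + b * s) (s * t)"
    if xy: "x \<in> frac a s" "y \<in> frac b t" for x y
  proof -
    obtain a' s' where x: "x = (\<phi> a', \<phi> s')" "s' \<in> T" "frac a' s' = frac a s"
      using frac_memD[OF xy(1) s] by blast
    obtain b' t' where y: "y = (\<phi> b', \<phi> t')" "t' \<in> T" "frac b' t' = frac b t"
      using frac_memD[OF xy(2) t] by blast
    have "a' * s - a * s' \<in> I" "b' * t - b * t' \<in> I"
      using x y s t by (auto simp: frac_eq_iff)
    then have "(t * t') * (a' * s - a * s') + (s * s') * (b' * t - b * t') \<in> I"
      by (intro cideal_add cideal_mult ideal_ker)
    then have "(a' * t' + b' * s') * (s * t) - (a * t + b * s) * (s' * t') \<in> I"
      by (simp add: algebra_simps)
    then have "frac (a' * t' + b' * s') (s' * t') = frac (a * t + b * s) (s * t)"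
      using frac_eq_iff T_mult x y s t by simp
    then show ?thesis by (simp add: x y frac_def hom_mult hom_add)
  qed
  then show ?thesis
    using frac_mem[OF s, of a] frac_mem[OF t, of b] by (auto simp: localization_def)
qed

lemma frac_one: "\<one>\<^bsub>L\<^esub> = frac 1 1" and frac_zero: "\<zero>\<^bsub>L\<^esub> = frac 0 1"
  by (simp_all add: localization_def frac_def)

lemma frac_closed: "s \<in> T \<Longrightarrow> frac a s \<in> carrier L"
  unfolding carrier_localization by blast

lemma frac_cases:
  assumes "x \<in> carrier L"
  obtains a s where "x = frac a s" "s \<in> T"
  using assms unfolding carrier_localization by blast

lemma cring_localization: "cring L"
proof (rule cringI)
  note simps = frac_one frac_zero frac_add frac_mult frac_closed T_mult T_one
  show "abelian_group L"
  proof (rule abelian_groupI)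
    fix x assume "x \<in> carrier L"
    then obtain a s where x: "x = frac a s" "s \<in> T" by (rule frac_cases)
    show "\<exists>y\<in>carrier L. y \<oplus>\<^bsub>L\<^esub> x = \<zero>\<^bsub>L\<^esub>"
      by (rule bexI[of _ "frac (- a) s"]) (use x in \<open>simp_all add: simps frac_eq_iff zero_in_ker\<close>)
  qed (simp add: simps | elim frac_cases, simp add: simps frac_eq_iff zero_in_ker algebra_simps)+
  show "comm_monoid L"
    by (rule comm_monoidI)
      (simp add: simps | elim frac_cases, simp add: simps frac_eq_iff zero_in_ker algebra_simps)+
qed (elim frac_cases, simp add: frac_add frac_mult T_mult frac_eq_iff zero_in_ker algebra_simps)

lemma fraction_hom_localization: "fraction_hom L (\<lambda>a. fraction R (\<phi> ` T) (\<phi> a) \<one>) I T"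
proof -
  have eq: "(\<lambda>a. fraction R (\<phi> ` T) (\<phi> a) \<one>) = (\<lambda>a. frac a 1)"
    by (simp add: frac_def)
  interpret L: cring L by (rule cring_localization)
  show ?thesis
    unfolding eq
  proof unfold_locales
    show "frac a 1 \<in> carrier L" for a using carrier_localization T_one by blast
    show "frac a 1 = \<zero>\<^bsub>L\<^esub> \<longleftrightarrow> a \<in> I" for a by (simp add: frac_zero frac_eq_iff T_one)
    fix t assume t: "t \<in> T"
    have "frac t 1 \<otimes>\<^bsub>L\<^esub> frac 1 t = \<one>\<^bsub>L\<^esub>"
      using t by (simp add: frac_mult frac_one T_one frac_eq_iff zero_in_ker)
    moreover have "frac 1 t \<in> carrier L" "frac t 1 \<in> carrier L"
      using carrier_localization T_one t by blast+
    ultimately show "frac t 1 \<in> Units L"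
      using L.m_comm unfolding Units_def by force
  next
    fix y assume "y \<in> carrier L"
    then obtain a s where "y = frac a s" "s \<in> T" by (auto simp: carrier_localization)
    then have "frac s 1 \<otimes>\<^bsub>L\<^esub> y = frac a 1"
      by (simp add: frac_mult T_one T_mult frac_eq_iff zero_in_ker)
    then show "\<exists>t\<in>T. \<exists>a. frac t 1 \<otimes>\<^bsub>L\<^esub> y = frac a 1" using \<open>s \<in> T\<close> by blast
  qed (auto simp: frac_add frac_mult frac_one T_one prime_ker T_mult T_ker)
qed

end

section \<open>Extension and contraction of ideals\<close>

locale local_hom = fraction_hom R \<phi> I "- M"
  for R :: "('b, 'c) ring_scheme" (structure) and \<phi> :: "'a::comm_ring_1 \<Rightarrow> 'b" and I M +
  assumes prime_M: "cprime M"
begin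

lemma ker_subset: "I \<subseteq> M"
  using denom_notin by blast

definition extension :: "'a set \<Rightarrow> 'b set" where
  "extension J = {y \<in> carrier R. \<exists>u a. u \<notin> M \<and> a \<in> J \<and> \<phi> u \<otimes> y = \<phi> a}"

definition contraction :: "'b set \<Rightarrow> 'a set" where
  "contraction Q = {a. \<phi> a \<in> Q}"

lemma extensionI: "y \<in> carrier R \<Longrightarrow> u \<notin> M \<Longrightarrow> a \<in> J \<Longrightarrow> \<phi> u \<otimes> y = \<phi> a \<Longrightarrow> y \<in> extension J"
  unfolding extension_def by blast

lemma ideal_extension:
  assumes "cideal J"
  shows "ideal (extension J) R"
proof (rule idealI)
  have mult: "x \<otimes> y \<in> extension J" if y: "y \<in> extension J" and x: "x \<in> carrier R" for x y
  proof -
    obtain u a where u: "y \<in> carrier R" "u \<notin> M" "a \<in> J" "\<phi> u \<otimes> y = \<phi> a"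
      using y unfolding extension_def by blast
    obtain v b where v: "v \<notin> M" "\<phi> v \<otimes> x = \<phi> b" using denominator[OF x] by blast
    show ?thesis
    proof (rule extensionI)
      show "u * v \<notin> M" using mult_denom[of u v] u v by simp
      show "b * a \<in> J" using cideal_mult assms u by blast
      have "\<phi> (u * v) \<otimes> (x \<otimes> y) = (\<phi> v \<otimes> x) \<otimes> (\<phi> u \<otimes> y)"
        using u(1) x by (simp add: hom_mult m_ac)
      then show "\<phi> (u * v) \<otimes> (x \<otimes> y) = \<phi> (b * a)" by (simp add: u v hom_mult)
    qed (use u x in auto)
  qed
  then show "\<And>a x. a \<in> extension J \<Longrightarrow> x \<in> carrier R \<Longrightarrow> x \<otimes> a \<in> extension J" .
  then show "\<And>a x. a \<in> extension J \<Longrightarrow> x \<in> carrier R \<Longrightarrow> a \<otimes> x \<in> extension J"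
    by (metis (lifting) m_comm extension_def mem_Collect_eq)
  show "subgroup (extension J) (add_monoid R)"
  proof (rule add.subgroupI)
    show "extension J \<subseteq> carrier R" unfolding extension_def by blast
    have "\<zero> \<in> extension J"
      by (rule extensionI[of _ 1 0]) (use one_denom cideal_zero[OF assms] in auto)
    then show "extension J \<noteq> {}" by blast
    fix y assume y: "y \<in> extension J"
    then have yc: "y \<in> carrier R" unfolding extension_def by blast
    have "\<ominus> \<one> \<otimes> y \<in> extension J" using mult[OF y] by simp
    then show "\<ominus> y \<in> extension J" using yc by (simp add: l_minus)
    fix z assume "z \<in> extension J"
    then obtain v b where v: "z \<in> carrier R" "v \<notin> M" "b \<in> J" "\<phi> v \<otimes> z = \<phi> b"
      unfolding extension_def by blast
    obtain u a where u: "u \<notin> M" "a \<in> J" "\<phi> u \<otimes> y = \<phi> a"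
      using y unfolding extension_def by blast
    show "y \<oplus> z \<in> extension J"
    proof (rule extensionI)
      show "u * v \<notin> M" using mult_denom[of u v] u v by simp
      show "v * a + u * b \<in> J" using cideal_mult cideal_add assms u v by blast
      have "\<phi> (u * v) \<otimes> (y \<oplus> z) = \<phi> v \<otimes> (\<phi> u \<otimes> y) \<oplus> \<phi> u \<otimes> (\<phi> v \<otimes> z)"
        using v(1) yc by (simp add: hom_mult m_ac r_distr)
      then show "\<phi> (u * v) \<otimes> (y \<oplus> z) = \<phi> (v * a + u * b)"
        by (simp add: u v hom_mult hom_add)
    qed (use v yc in auto)
  qed
qed (rule ring_axioms)

text \<open>Saturation is what makes an ideal the contraction of its extension; hence saturated
  ideals above \<open>I\<close> embed into the ideals of the local ring.\<close>

lemma hom_in_extension_iff: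
  assumes J: "saturated M J" and "I \<subseteq> J"
  shows "\<phi> a \<in> extension J \<longleftrightarrow> a \<in> J"
proof
  assume "\<phi> a \<in> extension J"
  then obtain u b where u: "u \<notin> M" "b \<in> J" "\<phi> u \<otimes> \<phi> a = \<phi> b" unfolding extension_def by blast
  then have "u * a - b \<in> J" using \<open>I \<subseteq> J\<close> by (auto simp: hom_eq_iff simp flip: hom_mult)
  then have "u * a \<in> J" using cideal_diff_iff[OF saturated_cideal[OF J]] u by blast
  then show "a \<in> J" using saturatedD[OF J u(1)] by blast
next
  assume "a \<in> J"
  then show "\<phi> a \<in> extension J"
    by (intro extensionI[of _ 1 a]) (use one_denom in auto)
qed

lemma extension_contraction:
  assumes Q: "ideal Q R"
  shows "extension (contraction Q) = Q"
proof -
  interpret Q: ideal Q R by fact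
  show ?thesis
  proof
    show "extension (contraction Q) \<subseteq> Q"
    proof
      fix y assume "y \<in> extension (contraction Q)"
      then obtain u a where u: "y \<in> carrier R" "u \<notin> M" "\<phi> a \<in> Q" "\<phi> u \<otimes> y = \<phi> a"
        unfolding extension_def contraction_def by blast
      then have "inv (\<phi> u) \<otimes> (\<phi> u \<otimes> y) \<in> Q"
        using Q.I_l_closed denom_unit[of u] by simp
      then show "y \<in> Q" using u(1,2) denom_unit[of u] by (simp flip: m_assoc)
    qed
    show "Q \<subseteq> extension (contraction Q)"
    proof
      fix y assume y: "y \<in> Q"
      then have yc: "y \<in> carrier R" by (rule Q.a_Hcarr)
      then obtain u a where ua: "u \<notin> M" "\<phi> u \<otimes> y = \<phi> a" using denominator by blast
      then have "\<phi> a \<in> Q" using Q.I_l_closed[OF y, of "\<phi> u"] by simp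
      then show "y \<in> extension (contraction Q)"
        using yc ua by (intro extensionI) (auto simp: contraction_def)
    qed
  qed
qed

lemma cprime_contraction:
  assumes Q: "primeideal Q R"
  shows "cprime (contraction Q)" "I \<subseteq> contraction Q" "contraction Q \<subseteq> M"
proof -
  interpret Q: primeideal Q R by fact
  have one: "\<one> \<notin> Q" using Q.one_imp_carrier Q.I_notcarr by blast
  show "cprime (contraction Q)"
    unfolding cprime_def cideal_def contraction_def
    using one Q.I_prime Q.I_l_closed Q.a_closed Q.zero_closed by (auto simp: hom_add hom_mult)
  show "I \<subseteq> contraction Q" unfolding contraction_def using Q.zero_closed hom_ker by (metis CollectI subsetI)
  show "contraction Q \<subseteq> M"
  proof
    fix a assume "a \<in> contraction Q"
    show "a \<in> M"
    proof (rule ccontr)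
      assume "a \<notin> M"
      then have "\<phi> a \<in> Units R" using denom_unit by simp
      then have "\<one> \<in> Q"
        using Q.I_l_closed[of "\<phi> a" "inv (\<phi> a)"] \<open>a \<in> contraction Q\<close>
        by (simp add: contraction_def)
      then show False using one by simp
    qed
  qed
qed

lemma contraction_strict_mono:
  assumes "ideal Q R" "ideal Q' R" "Q \<subset> Q'"
  shows "contraction Q \<subset> contraction Q'"
proof -
  have "contraction Q \<noteq> contraction Q'"
    using assms(3) extension_contraction[OF assms(1)] extension_contraction[OF assms(2)]
    by (metis less_irrefl)
  then show ?thesis using assms(3) unfolding contraction_def by blast
qed

text \<open>Elements outside \<open>M\<close> become units, so \<open>Q\<close> contracts into
  \<open>M\<close>; the extension of \<open>M\<close> is proper and contains \<open>Q\<close>, hence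
  equals it.\<close>

lemma contraction_maximalideal:
  assumes Q: "maximalideal Q R"
  shows "contraction Q = M"
proof -
  interpret Q: maximalideal Q R by fact
  have "contraction Q \<subseteq> M" using cprime_contraction maximalideal_prime[OF Q] by blast
  have Q_eq: "extension (contraction Q) = Q" by (rule extension_contraction[OF Q.ideal_axioms])
  have id: "ideal (extension M) R" by (rule ideal_extension[OF cprime_cideal[OF prime_M]])
  have satM: "saturated M M" by (rule cprime_saturated[OF prime_M order_refl])
  have "Q \<subseteq> extension M"
    using \<open>contraction Q \<subseteq> M\<close> Q_eq unfolding extension_def by blast
  moreover have "extension M \<subseteq> carrier R" unfolding extension_def by blast
  moreover have "extension M \<noteq> carrier R"
    using hom_in_extension_iff[OF satM ker_subset, of 1] cprime_one[OF prime_M] by auto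
  ultimately have "extension M = Q" using Q.I_maximal[OF id] by blast
  then show ?thesis
    using hom_in_extension_iff[OF satM ker_subset] unfolding contraction_def by blast
qed

text \<open>A nonempty chain of ideals in a noetherian ring contains its union, so Zorn's lemma
  gives a maximal extension. Extension is injective on saturated ideals above \<open>I\<close>, so
  maximality transfers back.\<close>

lemma local_noetherian:
  assumes "noetherian_ring R"
  shows "local_noetherian M I"
proof
  show "cprime M" by (rule prime_M)
  fix J and C :: "'a set set"
  assume J: "J \<in> C" and C: "\<And>J. J \<in> C \<Longrightarrow> saturated M J \<and> I \<subseteq> J"
  interpret noetherian_ring R by fact
  define E where "E = extension ` C"
  have "\<exists>Y\<in>E. \<forall>Z\<in>E. Y \<subseteq> Z \<longrightarrow> Z = Y"
  proof (rule subset_Zorn_nonempty)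
    show "E \<noteq> {}" using J unfolding E_def by blast
    fix D assume D: "D \<noteq> {}" "subset.chain E D"
    moreover have "ideal (extension K) R" if "K \<in> C" for K
      using ideal_extension C[OF that] saturated_cideal by blast
    ultimately have "subset.chain {I. ideal I R} D"
      unfolding subset_chain_def E_def by blast
    then have "\<Union> D \<in> D" using ideal_chain_is_trivial D by blast
    then show "\<Union> D \<in> E" using D unfolding subset_chain_def by blast
  qed
  then obtain K where K: "K \<in> C"
    and max: "\<And>L. L \<in> C \<Longrightarrow> extension K \<subseteq> extension L \<Longrightarrow> extension L = extension K"
    unfolding E_def by blast
  have "L = K" if L: "L \<in> C" "K \<subseteq> L" for L
  proof -
    have "extension K \<subseteq> extension L" using L unfolding extension_def by blast
    from max[OF L(1) this] have "extension L = extension K" .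
    then have "a \<in> L \<longleftrightarrow> a \<in> K" for a
      using hom_in_extension_iff[of L a] hom_in_extension_iff[of K a] C L K by simp
    then show ?thesis by blast
  qed
  then show "\<exists>K\<in>C. \<forall>L\<in>C. K \<subseteq> L \<longrightarrow> L = K" using K by blast
qed

lemma regular_parameters:
  assumes reg: "regular_local_ring R"
  shows "\<exists>xs P. local_noetherian.prime_chain M I (length xs) P M \<and> foldl (adjoin M) I xs = M"
proof -
  interpret N: local_noetherian M I
    using reg local_noetherian unfolding regular_local_ring_def by blast
  obtain G where G: "G \<subseteq> carrier R" "finite G" "maximalideal (Idl G) R" "enat (card G) = krull_dim R"
    using reg unfolding regular_local_ring_def by blast
  obtain gs where gs: "set gs = G" "length gs = card G"
    using finite_distinct_list[OF G(2)] distinct_card by metis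
  \<comment> \<open>The generators are fractions; multiplying each by a denominator, a unit of the
    local ring, gives parameters in the ambient ring.\<close>
  have "\<forall>g\<in>G. \<exists>a. \<exists>u. u \<notin> M \<and> \<phi> u \<otimes> g = \<phi> a" using denominator G(1) by blast
  from bchoice[OF this] obtain x where x: "\<forall>g\<in>G. \<exists>u. u \<notin> M \<and> \<phi> u \<otimes> g = \<phi> (x g)" by blast
  define xs where "xs = map x gs"
  have satI: "saturated M I" by (rule cprime_saturated[OF prime_ker ker_subset])
  have satM: "saturated M M" by (rule cprime_saturated[OF prime_M order_refl])
  define J where "J = foldl (adjoin M) I xs"
  have satJ: "saturated M J" unfolding J_def by (rule N.saturated_gens[OF satI])
  have IJ: "I \<subseteq> J" unfolding J_def by (rule N.gens_superset)
  have contr: "contraction (Idl G) = M" by (rule contraction_maximalideal[OF G(3)])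
  have idG: "ideal (Idl G) R" by (rule genideal_ideal[OF G(1)])
  have "x g \<in> M" if g: "g \<in> G" for g
  proof -
    obtain u where "\<phi> u \<otimes> g = \<phi> (x g)" using x g by blast
    moreover have "\<phi> u \<otimes> g \<in> Idl G"
      by (rule ideal.I_l_closed[OF idG]) (use genideal_self[OF G(1)] g in auto)
    ultimately have "x g \<in> contraction (Idl G)" unfolding contraction_def by simp
    then show ?thesis unfolding contr .
  qed
  then have "J \<subseteq> M"
    unfolding J_def using N.gens_least[OF satM ker_subset, of xs] gs by (auto simp: xs_def)
  have "G \<subseteq> extension J"
  proof
    fix g assume g: "g \<in> G"
    then obtain u where u: "u \<notin> M" "\<phi> u \<otimes> g = \<phi> (x g)" using x by blast
    have "x g \<in> J" unfolding J_def by (rule N.in_gens[OF satI]) (use g gs in \<open>auto simp: xs_def\<close>)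
    then show "g \<in> extension J" using u g G(1) by (intro extensionI[of _ u "x g"]) auto
  qed
  then have "Idl G \<subseteq> extension J"
    by (rule genideal_minimal[OF ideal_extension[OF saturated_cideal[OF satJ]]])
  then have "M \<subseteq> J"
    using hom_in_extension_iff[OF satJ IJ] contr unfolding contraction_def by blast
  then have JM: "foldl (adjoin M) I xs = M" using \<open>J \<subseteq> M\<close> unfolding J_def by blast
  define D where "D = {enat d | d. \<exists>P. (\<forall>i\<le>d. primeideal (P i) R) \<and> (\<forall>i<d. P i \<subset> P (Suc i))}"
  have "primeideal (Idl G) R" by (rule maximalideal_prime[OF G(3)])
  then have "enat 0 \<in> D" unfolding D_def by fastforce
  moreover have "Sup D = enat (card G)" using G(4) unfolding krull_dim_def D_def by simp
  \<comment> \<open>The supremum is finite and \<open>D\<close> is nonempty, so \<open>D\<close> is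
    finite and the supremum is attained by an actual chain.\<close>
  ultimately have "enat (card G) \<in> D"
    using Max_in[of D] unfolding Sup_enat_def
    by (metis (full_types) empty_iff enat.distinct(2) infinity_enat_def)
  then obtain P where P: "\<And>i. i \<le> card G \<Longrightarrow> primeideal (P i) R" "\<And>i. i < card G \<Longrightarrow> P i \<subset> P (Suc i)"
    unfolding D_def by auto
  have "N.prime_chain i (contraction (P 0)) (contraction (P i))" if "i \<le> card G" for i
    using that
  proof (induction i)
    case 0
    show ?case
      by (rule N.prime_chain_0) (use cprime_contraction[OF P(1)[of 0]] in auto)
  next
    case (Suc i)
    then have PS: "primeideal (P (Suc i)) R" and Pi: "primeideal (P i) R" using P(1) by auto
    have "contraction (P i) \<subset> contraction (P (Suc i))"
      by (rule contraction_strict_mono) (use Suc P(2) PS Pi primeideal.axioms(1) in auto)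
    then show ?case
      using N.prime_chain_Suc[OF Suc.IH] cprime_contraction[OF PS] Suc.prems by auto
  qed
  then have "N.prime_chain (length xs) (contraction (P 0)) (contraction (P (card G)))"
    using gs by (simp add: xs_def)
  \<comment> \<open>The chain has as many links as there are parameters, so its unspecified top
    prime has to contract to \<open>M\<close>.\<close>
  moreover from N.prime_chain_top[OF JM satI this] have "contraction (P (card G)) = M"
    using cprime_contraction[OF P(1)[of 0]] by auto
  ultimately show ?thesis using JM by auto
qed

end


section \<open>Polynomials on algebraic sets\<close>

definition monomial_value :: "'k::field ^ 's::finite \<Rightarrow> ('s \<Rightarrow>\<^sub>0 nat) \<Rightarrow> 'k" where
  "monomial_value x e = (\<Prod>i\<in>UNIV. (x $ i) ^ Poly_Mapping.lookup e i)"

lemma monomial_value_add: "monomial_value x (e + f) = monomial_value x e * monomial_value x f"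
  by (simp add: monomial_value_def lookup_add power_add prod.distrib)

lemma mpoly_eval_superset:
  assumes "finite A" "Poly_Mapping.keys p \<subseteq> A"
  shows "mpoly_eval x p = (\<Sum>e\<in>A. Poly_Mapping.lookup p e * monomial_value x e)"
  unfolding mpoly_eval_def monomial_value_def
  by (rule sum.mono_neutral_left) (use assms in \<open>auto simp: in_keys_iff\<close>)

lemma mpoly_eval_add: "mpoly_eval x (p + q) = mpoly_eval x p + mpoly_eval x q"
proof -
  define A where "A = Poly_Mapping.keys p \<union> Poly_Mapping.keys q"
  have A: "finite A" "Poly_Mapping.keys p \<subseteq> A" "Poly_Mapping.keys q \<subseteq> A" "Poly_Mapping.keys (p + q) \<subseteq> A"
    unfolding A_def using Poly_Mapping.keys_add[of p q] by auto
  show ?thesis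
    unfolding mpoly_eval_superset[OF A(1,2)] mpoly_eval_superset[OF A(1,3)] mpoly_eval_superset[OF A(1,4)]
    by (simp add: lookup_add distrib_right sum.distrib)
qed

lemma mpoly_eval_single: "mpoly_eval x (Poly_Mapping.single e c) = c * monomial_value x e"
  using mpoly_eval_superset[of "{e}" "Poly_Mapping.single e c" x] by simp

lemma mpoly_eval_zero [simp]: "mpoly_eval x 0 = 0"
  by (simp add: mpoly_eval_def)

lemma mpoly_eval_one [simp]: "mpoly_eval x 1 = 1"
  using mpoly_eval_single[of x 0 1] by (simp add: monomial_value_def)

lemma mpoly_eval_sum: "mpoly_eval x (sum f A) = (\<Sum>a\<in>A. mpoly_eval x (f a))"
  by (induction A rule: infinite_finite_induct) (simp_all add: mpoly_eval_add)

lemma sum_single_keys: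
  "(\<Sum>e\<in>Poly_Mapping.keys p. Poly_Mapping.single e (Poly_Mapping.lookup p e)) = p"
  by (rule poly_mapping_eqI)
    (simp add: lookup_sum lookup_single when_def sum.delta' in_keys_iff)

lemma mpoly_eval_mult: "mpoly_eval x (p * q) = mpoly_eval x p * mpoly_eval x q"
proof -
  let ?s = "\<lambda>p e. Poly_Mapping.single e (Poly_Mapping.lookup p e)"
  have "p * q = (\<Sum>e\<in>Poly_Mapping.keys p. \<Sum>f\<in>Poly_Mapping.keys q. ?s p e * ?s q f)"
    using sum_single_keys[of p] sum_single_keys[of q] by (simp flip: sum_product)
  then have "mpoly_eval x (p * q) = (\<Sum>e\<in>Poly_Mapping.keys p. \<Sum>f\<in>Poly_Mapping.keys q.
      (Poly_Mapping.lookup p e * monomial_value x e) * (Poly_Mapping.lookup q f * monomial_value x f))"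
    by (simp add: mpoly_eval_sum mult_single mpoly_eval_single monomial_value_add mult_ac)
  then show ?thesis by (simp add: mpoly_eval_def monomial_value_def sum_product)
qed

lemma mpoly_eval_uminus: "mpoly_eval x (- p) = - mpoly_eval x p"
  using mpoly_eval_add[of x p "- p"] by (simp add: eq_neg_iff_add_eq_0 add.commute)

lemma mpoly_eval_diff: "mpoly_eval x (p - q) = mpoly_eval x p - mpoly_eval x q"
  using mpoly_eval_add[of x p "- q"] by (simp add: mpoly_eval_uminus)

lemma mpoly_eval_power: "mpoly_eval x (p ^ n) = mpoly_eval x p ^ n"
  by (induction n) (simp_all add: mpoly_eval_mult)

definition mpoly_const :: "'k::field \<Rightarrow> ('s, 'k) mpoly" where
  "mpoly_const c = Poly_Mapping.single 0 c"

definition mpoly_var :: "'s \<Rightarrow> ('s, 'k::field) mpoly" where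
  "mpoly_var i = Poly_Mapping.single (Poly_Mapping.single i 1) 1"

lemma mpoly_eval_const [simp]: "mpoly_eval x (mpoly_const c) = c"
  by (simp add: mpoly_const_def mpoly_eval_single monomial_value_def)

lemma mpoly_eval_var [simp]: "mpoly_eval x (mpoly_var i) = x $ i"
proof -
  have "monomial_value x (Poly_Mapping.single i 1) = (\<Prod>j\<in>UNIV. if j = i then x $ j else 1)"
    unfolding monomial_value_def by (rule prod.cong) (auto simp: lookup_single when_def)
  then show ?thesis by (simp add: mpoly_var_def mpoly_eval_single)
qed

lemma mpoly_const_add: "mpoly_const (a + b) = mpoly_const a + mpoly_const b"
  and mpoly_const_mult: "mpoly_const (a * b) = mpoly_const a * mpoly_const b"
  and mpoly_const_uminus: "mpoly_const (- a) = - mpoly_const a"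
  and mpoly_const_zero [simp]: "mpoly_const 0 = 0"
  and mpoly_const_one [simp]: "mpoly_const 1 = 1"
  by (simp_all add: mpoly_const_def single_add mult_single single_uminus)

lemma mpoly_const_power: "mpoly_const (a ^ n) = mpoly_const a ^ n"
  by (induction n) (simp_all add: mpoly_const_mult)

lemma mpoly_const_sum: "mpoly_const (sum f A) = (\<Sum>i\<in>A. mpoly_const (f i))"
  by (induction A rule: infinite_finite_induct) (simp_all add: mpoly_const_add)

lemma CHAR_mpoly: "CHAR(('s, 'k::field) mpoly) = CHAR('k)"
proof (rule CHAR_eqI)
  have *: "of_nat n = (mpoly_const (of_nat n) :: ('s, 'k) mpoly)" for n
    by (simp add: mpoly_const_def)
  show "of_nat CHAR('k) = (0 :: ('s, 'k) mpoly)" by (simp add: *)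
  show "CHAR('k) dvd n" if "of_nat n = (0 :: ('s, 'k) mpoly)" for n
  proof -
    have "mpoly_const (of_nat n :: 'k) = (0 :: ('s, 'k) mpoly)" using that * by metis
    then have "of_nat n = (0 :: 'k)"
      unfolding mpoly_const_def by (metis lookup_single_eq lookup_zero)
    then show ?thesis by (simp add: of_nat_eq_0_iff_char_dvd)
  qed
qed

section \<open>Vanishing ideals and the coordinate ring\<close>

lemma cideal_vanishing_ideal: "cideal (vanishing_ideal V)"
  by (auto simp: cideal_def vanishing_ideal_def mpoly_eval_add mpoly_eval_mult)

lemma cprime_vanishing_ideal_point: "cprime (vanishing_ideal {x})"
  unfolding cprime_def using cideal_vanishing_ideal[of "{x}"]
  by (auto simp: vanishing_ideal_def mpoly_eval_mult)

lemma cprime_vanishing_ideal: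
  assumes "irreducible_algebraic_set V"
  shows "cprime (vanishing_ideal V)"
  unfolding cprime_def
proof (intro conjI allI impI)
  have V: "algebraic_set V" "V \<noteq> {}"
    and irr: "\<And>V1 V2. algebraic_set V1 \<Longrightarrow> algebraic_set V2 \<Longrightarrow> V = V1 \<union> V2 \<Longrightarrow> V = V1 \<or> V = V2"
    using assms unfolding irreducible_algebraic_set_def by blast+
  show "cideal (vanishing_ideal V)" by (rule cideal_vanishing_ideal)
  show "1 \<notin> vanishing_ideal V" using V by (auto simp: vanishing_ideal_def)
  fix p q assume pq: "p * q \<in> vanishing_ideal V"
  have alg: "algebraic_set {x \<in> V. mpoly_eval x r = 0}" for r
  proof -
    obtain S where S: "V = {x. \<forall>p\<in>S. mpoly_eval x p = 0}"
      using V unfolding algebraic_set_def by blast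
    show ?thesis
      unfolding algebraic_set_def by (rule exI[of _ "insert r S"]) (auto simp: S)
  qed
  have "V = {x \<in> V. mpoly_eval x p = 0} \<union> {x \<in> V. mpoly_eval x q = 0}"
    using pq by (auto simp: vanishing_ideal_def mpoly_eval_mult)
  from irr[OF alg alg this] show "p \<in> vanishing_ideal V \<or> q \<in> vanishing_ideal V"
    unfolding vanishing_ideal_def by blast
qed

text \<open>A coordinate function separates \<open>x\<close> from a second point of
  \<open>V\<close>. This is how positive dimension enters: the list of parameters cannot be
  empty.\<close>

lemma irreducible_not_point:
  assumes "\<forall>x. V \<noteq> {x}" "x \<in> V"
  shows "vanishing_ideal V \<noteq> vanishing_ideal {x}"
proof
  assume eq: "vanishing_ideal V = vanishing_ideal {x}"
  obtain y where y: "y \<in> V" "y \<noteq> x" using assms by blast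
  then obtain i where i: "y $ i \<noteq> x $ i" by (metis vec_eq_iff)
  have "mpoly_var i - mpoly_const (x $ i) \<in> vanishing_ideal {x}"
    by (simp add: vanishing_ideal_def mpoly_eval_diff)
  then have "mpoly_var i - mpoly_const (x $ i) \<in> vanishing_ideal V" using eq by simp
  then show False using y i by (auto simp: vanishing_ideal_def mpoly_eval_diff)
qed

lemma ring_of_type_algebra_simps [simp]:
  "carrier ring_of_type_algebra = UNIV"
  "x \<otimes>\<^bsub>ring_of_type_algebra\<^esub> y = x * y" "x \<oplus>\<^bsub>ring_of_type_algebra\<^esub> y = x + y"
  "\<one>\<^bsub>ring_of_type_algebra\<^esub> = 1" "\<zero>\<^bsub>ring_of_type_algebra\<^esub> = 0"
  by (simp_all add: ring_of_type_algebra_def)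

lemma ideal_of_cideal:
  assumes "cideal J"
  shows "ideal J ring_of_type_algebra"
proof (rule idealI)
  interpret ring "ring_of_type_algebra :: 'a ring" by (rule ring_from_type_algebra)
  show "subgroup J (add_monoid ring_of_type_algebra)"
  proof (rule add.subgroupI)
    fix a assume "a \<in> J"
    moreover have "\<ominus>\<^bsub>ring_of_type_algebra\<^esub> a = - a" by (rule minus_equality) auto
    ultimately show "\<ominus>\<^bsub>ring_of_type_algebra\<^esub> a \<in> J" using cideal_uminus[OF assms] by simp
  qed (use cideal_zero[OF assms] cideal_add[OF assms] in auto)
qed (use ring_from_type_algebra cideal_mult[OF assms] cideal_mult2[OF assms] in auto)

lemma fraction_hom_coordinate_ring:
  assumes "irreducible_algebraic_set V"
  shows "fraction_hom (coordinate_ring V) (\<lambda>p. vanishing_ideal V +>\<^bsub>mpoly_ring\<^esub> p) (vanishing_ideal V) {1}"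
proof -
  interpret ideal "vanishing_ideal V" mpoly_ring
    by (rule ideal_of_cideal[OF cideal_vanishing_ideal])
  have hom: "(+>\<^bsub>mpoly_ring\<^esub>) (vanishing_ideal V) \<in> ring_hom mpoly_ring (coordinate_ring V)"
    unfolding coordinate_ring_def by (rule rcos_ring_hom)
  interpret Q: cring "coordinate_ring V"
    unfolding coordinate_ring_def by (rule quotient_is_cring[OF cring_from_type_algebra])
  note homs = ring_hom_closed[OF hom] ring_hom_add[OF hom] ring_hom_mult[OF hom] ring_hom_one[OF hom]
  have carr: "carrier (coordinate_ring V) = range (\<lambda>p. vanishing_ideal V +>\<^bsub>mpoly_ring\<^esub> p)"
    by (auto simp: coordinate_ring_def FactRing_def A_RCOSETS_def')
  show ?thesis
  proof unfold_locales
    fix p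
    have "vanishing_ideal V +>\<^bsub>mpoly_ring\<^esub> p = vanishing_ideal V \<longleftrightarrow> p \<in> vanishing_ideal V"
      using a_rcos_const rcos_const_imp_mem by auto
    then show "vanishing_ideal V +>\<^bsub>mpoly_ring\<^esub> p = \<zero>\<^bsub>coordinate_ring V\<^esub> \<longleftrightarrow> p \<in> vanishing_ideal V"
      by (simp add: coordinate_ring_def FactRing_def)
  next
    fix y assume "y \<in> carrier (coordinate_ring V)"
    then show "\<exists>t\<in>{1}. \<exists>a. (vanishing_ideal V +>\<^bsub>mpoly_ring\<^esub> t) \<otimes>\<^bsub>coordinate_ring V\<^esub> y
        = vanishing_ideal V +>\<^bsub>mpoly_ring\<^esub> a"
      using homs Q.l_one carr by auto
  qed (use homs cprime_vanishing_ideal[OF assms] cprime_one[OF cprime_vanishing_ideal[OF assms]] Q.Units_one_closed in auto)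
qed


section \<open>Levels and Waring numbers of coordinate rings\<close>

lemma fraction_hom_base_field:
  "fraction_hom (base_field TYPE('k::field)) (\<lambda>x. x) {0} {1}"
proof -
  interpret cring "base_field TYPE('k)"
    unfolding base_field_def by (rule cring_from_type_algebra)
  have "1 \<in> Units (base_field TYPE('k))" using Units_one_closed by (simp add: base_field_def)
  then show ?thesis
    by unfold_locales (auto simp: base_field_def cprime_def cideal_def)
qed

lemma sum_of_powers_base_field:
  "sum_of_powers (base_field TYPE('k::field)) n g x \<longleftrightarrow> (\<exists>c. x = (\<Sum>i<g. c i ^ n))"
  using fraction_hom.sum_of_powers_hom_iff[OF fraction_hom_base_field, of n g x] by auto

lemma base_field_minus_one: "\<ominus>\<^bsub>base_field TYPE('k::field)\<^esub> \<one>\<^bsub>base_field TYPE('k)\<^esub> = - 1"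
proof -
  interpret ring "base_field TYPE('k)"
    unfolding base_field_def by (rule ring_from_type_algebra)
  show ?thesis by (rule minus_equality) (auto simp: base_field_def)
qed

lemma level_base_field:
  "level n (base_field TYPE('k::field)) = Inf {enat g | g. 0 < g \<and> (\<exists>c. (- 1 :: 'k) = (\<Sum>i<g. c i ^ n))}"
  unfolding level_def base_field_minus_one sum_of_powers_base_field ..

lemma level_le:
  "0 < g \<Longrightarrow> (- 1 :: 'k::field) = (\<Sum>i<g. c i ^ n) \<Longrightarrow> level n (base_field TYPE('k)) \<le> enat g"
  unfolding level_base_field by (intro Inf_lower) blast

lemma level_witness:
  assumes "level n (base_field TYPE('k::field)) < \<infinity>"
  obtains g c where "level n (base_field TYPE('k)) = enat g" "0 < g" "(- 1 :: 'k) = (\<Sum>i<g. c i ^ n)"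
proof -
  let ?S = "{enat g | g. 0 < g \<and> (\<exists>c. (- 1 :: 'k) = (\<Sum>i<g. c i ^ n))}"
  have "?S \<noteq> {}" using assms unfolding level_base_field Inf_enat_def by force
  then have "Inf ?S \<in> ?S"
    unfolding Inf_enat_def using LeastI_ex[of "\<lambda>x. x \<in> ?S"] by auto
  then show ?thesis using that unfolding level_base_field by blast
qed

lemma sum_powers_reindex:
  assumes "finite A"
  obtains c where "(\<Sum>i\<in>A. f i ^ n) = (\<Sum>i<card A. c i ^ n)"
proof -
  obtain b where "bij_betw b {0..<card A} A" using ex_bij_betw_nat_finite[OF assms] by blast
  then have "(\<Sum>i\<in>A. f i ^ n) = (\<Sum>i<card A. f (b i) ^ n)"
    by (simp add: sum.reindex_bij_betw[symmetric] lessThan_atLeast0)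
  then show ?thesis by (rule that)
qed

text \<open>Dividing a nontrivial zero by a nonzero coordinate leaves -1 as a sum of one power
  fewer. Thus a sum of at most \<open>s\<close> powers is anisotropic when the level is
  \<open>s\<close>, and a sum of any number of powers is when the level is infinite.\<close>

lemma level_le_card:
  assumes A: "finite A" "j \<in> A" and b: "b j \<noteq> (0::'k::field)" "(\<Sum>i\<in>A. b i ^ n) = 0"
  shows "level n (base_field TYPE('k)) \<le> enat (card A - 1)"
proof -
  have "b j ^ n + (\<Sum>i\<in>A - {j}. b i ^ n) = 0" using b(2) sum.remove[OF A] by metis
  then have "(\<Sum>i\<in>A - {j}. b i ^ n) = - (b j ^ n)" by (simp add: eq_neg_iff_add_eq_0 add.commute)
  then have "(\<Sum>i\<in>A - {j}. (b i / b j) ^ n) = - 1"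
    using b(1) by (simp add: power_divide flip: sum_divide_distrib)
  moreover obtain c where "(\<Sum>i\<in>A - {j}. (b i / b j) ^ n) = (\<Sum>i<card (A - {j}). c i ^ n)"
    using sum_powers_reindex[of "A - {j}" "\<lambda>i. b i / b j" n] A by blast
  ultimately have c: "- 1 = (\<Sum>i<card (A - {j}). c i ^ n)" by simp
  \<comment> \<open>The empty sum would give -1 = 0.\<close>
  then have "0 < card (A - {j})" by (cases "card (A - {j})") auto
  from level_le[OF this c] show ?thesis using A by simp
qed

text \<open>The condition inside the infimum: comparing Waring numbers reduces to carrying single
  bounds from one ring to another, with infinite values covered as well.\<close>

definition waring_bound :: "nat \<Rightarrow> ('a, 'b) ring_scheme \<Rightarrow> nat \<Rightarrow> bool" where
  "waring_bound n R g \<longleftrightarrow> 0 < g \<and>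
    (\<forall>x\<in>carrier R. (\<exists>h. sum_of_powers R n h x) \<longrightarrow> (\<exists>h\<le>g. sum_of_powers R n h x))"

lemma waring_boundD:
  assumes "waring_bound n R g" "x \<in> carrier R" "sum_of_powers R n h x"
  obtains h' where "h' \<le> g" "sum_of_powers R n h' x"
  using assms unfolding waring_bound_def by blast

lemma waring_boundI:
  assumes "0 < g" "\<And>x h. x \<in> carrier R \<Longrightarrow> sum_of_powers R n h x \<Longrightarrow> \<exists>h\<le>g. sum_of_powers R n h x"
  shows "waring_bound n R g"
  using assms unfolding waring_bound_def by blast

lemma waring_bound_pos: "waring_bound n R g \<Longrightarrow> 0 < g"
  by (simp add: waring_bound_def)

lemma waring_number_eq: "waring_number n R = Inf {enat g | g. waring_bound n R g}"
  by (simp add: waring_number_def waring_bound_def)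

lemma waring_number_geI: "(\<And>g. waring_bound n R g \<Longrightarrow> w \<le> enat g) \<Longrightarrow> w \<le> waring_number n R"
  unfolding waring_number_eq by (auto intro: Inf_greatest)

lemma waring_number_le: "waring_bound n R g \<Longrightarrow> waring_number n R \<le> enat g"
  unfolding waring_number_eq by (auto intro: Inf_lower)

lemma waring_number_mono:
  "(\<And>g. waring_bound n R g \<Longrightarrow> waring_bound m R' g) \<Longrightarrow> waring_number m R' \<le> waring_number n R"
  by (auto intro: waring_number_geI waring_number_le)

section \<open>Reduction to the part of the exponent prime to the characteristic\<close>

lemma additive_power_cancel:
  fixes a b :: "'a::comm_ring_1"
  assumes add: "\<And>x y :: 'a. (x + y) ^ q = x ^ q + y ^ q" and I: "cprime I" "a ^ q - b ^ q \<in> I"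
  shows "a - b \<in> I"
proof -
  have "a ^ q = b ^ q + (a - b) ^ q" using add[of b "a - b"] by simp
  then have "(a - b) ^ q \<in> I" using I(2) by simp
  then show ?thesis using cprime_power[OF I(1)] by blast
qed

text \<open>\<open>q\<close> is the power of the characteristic in \<open>n\<close>, or 1 in
  characteristic zero. Additivity is needed both for scalars and for polynomials, where relations
  are held before reduction modulo \<open>I\<close>.\<close>

lemma free_part_decompose:
  fixes n :: nat
  assumes "0 < n"
  defines "m \<equiv> free_part CHAR('k::field) n"
  shows "\<exists>q. n = m * q \<and> 0 < m \<and> 0 < q \<and> of_nat m \<noteq> (0::'k) \<and>
    (\<forall>x y :: 'k. (x + y) ^ q = x ^ q + y ^ q) \<and>
    (\<forall>x y :: ('s, 'k) mpoly. (x + y) ^ q = x ^ q + y ^ q)"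
proof (cases "CHAR('k) = 0")
  case True
  then have "n = m * 1" by (simp add: m_def free_part_def)
  moreover have "of_nat m \<noteq> (0::'k)"
    using True assms by (simp add: of_nat_eq_0_iff_char_dvd m_def free_part_def)
  ultimately show ?thesis using assms by (intro exI[of _ 1]) auto
next
  case False
  define p where "p = CHAR('k)"
  have p: "prime p" unfolding p_def using prime_CHAR_semidom[where 'a = 'k] False by simp
  define j where "j = multiplicity p n"
  have "\<not> is_unit p" using p not_prime_unit by blast
  then obtain r where r: "n = p ^ j * r" "\<not> p dvd r"
    using multiplicity_decompose'[of n p] assms unfolding j_def by auto
  have "m = n div p ^ j" using False by (simp add: m_def free_part_def p_def j_def)
  moreover have "n div p ^ j = r" unfolding r(1) using p by (simp add: prime_gt_0_nat)
  ultimately have "m = r" by simp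
  show ?thesis
  proof (intro exI[of _ "p ^ j"] conjI allI)
    show "n = m * p ^ j" using r \<open>m = r\<close> by simp
    show "0 < m" using r \<open>m = r\<close> assms by (intro gr0I) auto
    show "0 < p ^ j" using p by (simp add: prime_gt_0_nat)
    show "of_nat m \<noteq> (0::'k)" using r \<open>m = r\<close> by (simp add: of_nat_eq_0_iff_char_dvd p_def)
    show "(x + y) ^ p ^ j = x ^ p ^ j + y ^ p ^ j" for x y :: 'k
      using freshmans_dream'[where 'a = 'k] p by (simp add: p_def)
    show "(x + y) ^ p ^ j = x ^ p ^ j + y ^ p ^ j" for x y :: "('s, 'k) mpoly"
      using freshmans_dream'[where 'a = "('s, 'k) mpoly"] p by (simp add: p_def CHAR_mpoly)
  qed
qed

lemma additive_power_sum:
  fixes f :: "'b \<Rightarrow> 'a::comm_ring_1"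
  assumes "\<And>x y :: 'a. (x + y) ^ q = x ^ q + y ^ q" "0 < q"
  shows "(\<Sum>i\<in>A. f i ^ m) ^ q = (\<Sum>i\<in>A. f i ^ (m * q))"
  by (induction A rule: infinite_finite_induct) (use assms in \<open>auto simp: power_mult zero_power\<close>)

text \<open>The \<open>q\<close>-th power of a sum of m-th powers in k is a sum of n-th powers of
  constants. It is shortened in k[V], evaluated at a point of \<open>V\<close>, and
  \<open>q\<close>-th roots are taken. The evaluation relies on the absence of denominators.\<close>

lemma waring_bound_coordinate_ring:
  fixes V :: "('k::field ^ 's::finite) set"
  assumes V: "irreducible_algebraic_set V" "x \<in> V" and n: "0 < n"
    and g: "waring_bound n (coordinate_ring V) g"
  shows "waring_bound (free_part CHAR('k) n) (base_field TYPE('k)) g"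
proof (rule waring_boundI)
  define m where "m = free_part CHAR('k) n"
  obtain q where nq: "n = m * q" "0 < q" and "\<forall>x y :: 'k. (x + y) ^ q = x ^ q + y ^ q"
    using free_part_decompose[where 'k = 'k and 's = 's, OF n] unfolding m_def by (elim exE conjE)
  note add = this(3)[rule_format]
  interpret A: fraction_hom "coordinate_ring V" "\<lambda>p. vanishing_ideal V +>\<^bsub>mpoly_ring\<^esub> p"
      "vanishing_ideal V" "{1}"
    by (rule fraction_hom_coordinate_ring[OF V(1)])
  show "0 < g" using g by (rule waring_bound_pos)
  fix y :: 'k and h
  assume "sum_of_powers (base_field TYPE('k)) (free_part CHAR('k) n) h y"
  then obtain c where c: "y = (\<Sum>i<h. c i ^ m)" by (auto simp: sum_of_powers_base_field m_def)
  define p :: "('s, 'k) mpoly" where "p = (\<Sum>i<h. mpoly_const (c i) ^ n)"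
  have "sum_of_powers (coordinate_ring V) n h (vanishing_ideal V +>\<^bsub>mpoly_ring\<^esub> p)"
    unfolding A.sum_of_powers_hom_iff
    by (intro bexI[of _ 1] exI[of _ "\<lambda>i. mpoly_const (c i)"]) (auto simp: p_def A.zero_in_ker)
  then obtain h' where "h' \<le> g" "sum_of_powers (coordinate_ring V) n h' (vanishing_ideal V +>\<^bsub>mpoly_ring\<^esub> p)"
    using waring_boundD[OF g A.hom_closed] by blast
  then obtain b where b: "p - (\<Sum>i<h'. b i ^ n) \<in> vanishing_ideal V"
    by (auto simp: A.sum_of_powers_hom_iff)
  have "y ^ q = (\<Sum>i<h. c i ^ n)" unfolding c nq by (rule additive_power_sum[OF add nq(2)])
  also have "\<dots> = mpoly_eval x p" by (simp add: p_def mpoly_eval_sum mpoly_eval_power)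
  also have "\<dots> = (\<Sum>i<h'. mpoly_eval x (b i) ^ n)"
    using b V(2) by (simp add: vanishing_ideal_def mpoly_eval_diff mpoly_eval_sum mpoly_eval_power)
  also have "\<dots> = (\<Sum>i<h'. mpoly_eval x (b i) ^ m) ^ q"
    unfolding nq by (rule additive_power_sum[OF add nq(2), symmetric])
  finally have "y ^ q - (\<Sum>i<h'. mpoly_eval x (b i) ^ m) ^ q \<in> {0}" by simp
  then have "y - (\<Sum>i<h'. mpoly_eval x (b i) ^ m) \<in> {0}"
    by (rule additive_power_cancel[OF add fraction_hom.prime_ker[OF fraction_hom_base_field]])
  then have "sum_of_powers (base_field TYPE('k)) (free_part CHAR('k) n) h' y"
    unfolding sum_of_powers_base_field m_def[symmetric] by (intro exI[of _ "\<lambda>i. mpoly_eval x (b i)"]) simp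
  then show "\<exists>h\<le>g. sum_of_powers (base_field TYPE('k)) (free_part CHAR('k) n) h y"
    using \<open>h' \<le> g\<close> by blast
qed

text \<open>Multiplying \<open>y\<close> by \<open>u ^ n\<close> gives a sum of n-th powers that
  already lives in \<open>A\<close>; it is shortened there and divided by \<open>u ^ n\<close>
  again.\<close>

lemma waring_bound_fractions:
  assumes A: "fraction_hom A \<phi> I {1}" and K: "fraction_hom K \<psi> I T"
    and g: "waring_bound n A g"
  shows "waring_bound n K g"
proof (rule waring_boundI)
  interpret A: fraction_hom A \<phi> I "{1}" by fact
  interpret K: fraction_hom K \<psi> I T by fact
  show "0 < g" using g by (rule waring_bound_pos)
  fix y h assume y: "y \<in> carrier K" and "sum_of_powers K n h y"
  then obtain u c where u: "u \<in> T" "\<psi> (u ^ n) \<otimes>\<^bsub>K\<^esub> y = \<psi> (\<Sum>i<h. c i ^ n)"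
    using K.sum_of_powers_iff by blast
  have "sum_of_powers A n h (\<phi> (\<Sum>i<h. c i ^ n))"
    unfolding A.sum_of_powers_hom_iff
    by (intro bexI[of _ 1] exI[of _ c]) (auto simp: A.zero_in_ker)
  then obtain h' where h': "h' \<le> g" "sum_of_powers A n h' (\<phi> (\<Sum>i<h. c i ^ n))"
    using waring_boundD[OF g A.hom_closed] by blast
  then obtain b where "(\<Sum>i<h. c i ^ n) - (\<Sum>i<h'. b i ^ n) \<in> I"
    by (auto simp: A.sum_of_powers_hom_iff)
  then have "\<psi> (\<Sum>i<h. c i ^ n) = \<psi> (\<Sum>i<h'. b i ^ n)" using K.hom_eq_iff by blast
  then have "\<psi> (u ^ n) \<otimes>\<^bsub>K\<^esub> y = \<psi> (\<Sum>i<h'. b i ^ n)" using u(2) by metis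
  then have "sum_of_powers K n h' y" unfolding K.sum_of_powers_iff[OF y] using u(1) by blast
  then show "\<exists>h\<le>g. sum_of_powers K n h y" using h'(1) by blast
qed


lemma level_free_part_le:
  assumes "n = m * q" "level n (base_field TYPE('k::field)) < \<infinity>"
  shows "level m (base_field TYPE('k)) < \<infinity>"
proof -
  obtain g and c :: "nat \<Rightarrow> 'k" where "level n (base_field TYPE('k)) = enat g" "0 < g"
    "- 1 = (\<Sum>i<g. c i ^ n)"
    by (rule level_witness[OF assms(2)])
  then have "(- 1 :: 'k) = (\<Sum>i<g. (c i ^ q) ^ m)"
    by (simp add: assms(1) mult.commute flip: power_mult)
  from enat_ile[OF level_le[OF \<open>0 < g\<close> this]] show ?thesis by auto
qed

section \<open>Varieties with a regular point\<close>

locale regular_variety =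
  fixes V :: "('k::field ^ 's::finite) set" and x
  assumes irreducible: "irreducible_algebraic_set V"
    and not_point: "\<forall>y. V \<noteq> {y}"
    and regular: "regular_point V x"
begin

definition I :: "('s, 'k) mpoly set" where "I = vanishing_ideal V"

definition M :: "('s, 'k) mpoly set" where "M = vanishing_ideal {x}"

abbreviation residue :: "('s, 'k) mpoly \<Rightarrow> ('s, 'k) mpoly set" where
  "residue \<equiv> (\<lambda>p. vanishing_ideal V +>\<^bsub>mpoly_ring\<^esub> p)"

lemma in_V: "x \<in> V"
  using regular by (simp add: regular_point_def)

lemma prime_I: "cprime I"
  unfolding I_def by (rule cprime_vanishing_ideal[OF irreducible])

lemma prime_M: "cprime M"
  unfolding M_def by (rule cprime_vanishing_ideal_point)

lemma in_M_iff: "p \<in> M \<longleftrightarrow> mpoly_eval x p = 0"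
  by (simp add: M_def vanishing_ideal_def)

lemma I_subset_M: "I \<subseteq> M"
  using in_V by (auto simp: I_def M_def vanishing_ideal_def)

lemma coordinate_hom: "fraction_hom (coordinate_ring V) residue I {1}"
  unfolding I_def by (rule fraction_hom_coordinate_ring[OF irreducible])

lemma localization_hom:
  assumes "1 \<in> T" "\<And>s t. s \<in> T \<Longrightarrow> t \<in> T \<Longrightarrow> s * t \<in> T" "\<And>t. t \<in> T \<Longrightarrow> t \<notin> I"
  shows "\<exists>\<psi>. fraction_hom (localization (coordinate_ring V) (residue ` T)) \<psi> I T"
proof -
  interpret fraction_hom "coordinate_ring V" residue I "{1}" by (rule coordinate_hom)
  interpret surjective_hom "coordinate_ring V" residue I T
    by unfold_locales (use assms in auto)
  show ?thesis using fraction_hom_localization by blast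
qed

lemma function_field_hom: "\<exists>\<psi>. fraction_hom (function_field V) \<psi> I (- I)"
proof -
  interpret fraction_hom "coordinate_ring V" residue I "{1}" by (rule coordinate_hom)
  have "carrier (coordinate_ring V) \<subseteq> range residue" using denominator by force
  then have "carrier (coordinate_ring V) - {\<zero>\<^bsub>coordinate_ring V\<^esub>} = residue ` (- I)"
    using hom_ker hom_closed by (auto simp: image_iff)
  moreover have "\<exists>\<psi>. fraction_hom (localization (coordinate_ring V) (residue ` (- I))) \<psi> I (- I)"
    by (rule localization_hom) (use cprime_one[OF prime_I] cprime_mult[OF prime_I] in blast)+
  ultimately show ?thesis
    unfolding function_field_def fraction_field_def by metis
qed

lemma local_ring_hom: "\<exists>\<psi>. local_hom
    (localization (coordinate_ring V) (carrier (coordinate_ring V) - point_ideal V x)) \<psi> I M"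
proof -
  interpret fraction_hom "coordinate_ring V" residue I "{1}" by (rule coordinate_hom)
  have "carrier (coordinate_ring V) \<subseteq> range residue" using denominator by force
  moreover have "residue p \<in> point_ideal V x \<longleftrightarrow> p \<in> M" for p
  proof
    assume "residue p \<in> point_ideal V x"
    then obtain r where "residue p = residue r" "r \<in> M" by (auto simp: point_ideal_def in_M_iff)
    then have "p - r \<in> M" using hom_eq_iff I_subset_M by blast
    then show "p \<in> M" using cideal_diff_iff[OF cprime_cideal[OF prime_M]] \<open>r \<in> M\<close> by blast
  qed (auto simp: point_ideal_def in_M_iff)
  ultimately have "carrier (coordinate_ring V) - point_ideal V x = residue ` (- M)"
    using hom_closed by (auto simp: image_iff)
  moreover obtain \<psi> where "fraction_hom (localization (coordinate_ring V) (residue ` (- M))) \<psi> I (- M)"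
  proof -
    have "\<exists>\<psi>. fraction_hom (localization (coordinate_ring V) (residue ` (- M))) \<psi> I (- M)"
      by (rule localization_hom)
        (use cprime_one[OF prime_M] cprime_mult[OF prime_M] I_subset_M in blast)+
    then show ?thesis using that by blast
  qed
  ultimately show ?thesis
    using prime_M unfolding local_hom_def local_hom_axioms_def by metis
qed

lemma parameters:
  shows "local_noetherian M I"
    and "\<exists>t ts P. local_noetherian.prime_chain M I (length (t # ts)) P M \<and> foldl (adjoin M) I (t # ts) = M"
proof -
  obtain \<psi> where \<psi>: "local_hom
      (localization (coordinate_ring V) (carrier (coordinate_ring V) - point_ideal V x)) \<psi> I M"
    using local_ring_hom by blast
  interpret local_hom "localization (coordinate_ring V) (carrier (coordinate_ring V) - point_ideal V x)" \<psi> I M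
    by (rule \<psi>)
  have reg: "regular_local_ring (localization (coordinate_ring V) (carrier (coordinate_ring V) - point_ideal V x))"
    using regular by (simp add: regular_point_def)
  then show "local_noetherian M I"
    using local_noetherian unfolding regular_local_ring_def by blast
  obtain xs P where xs: "local_noetherian.prime_chain M I (length xs) P M" "foldl (adjoin M) I xs = M"
    using regular_parameters[OF reg] by blast
  \<comment> \<open>With an empty list of parameters the ideal they generate over \<open>I\<close>
    would be \<open>I\<close> itself.\<close>
  have "I \<noteq> M" unfolding I_def M_def by (rule irreducible_not_point[OF not_point in_V])
  then obtain t ts where "xs = t # ts" using xs(2) by (cases xs) auto
  then show "\<exists>t ts P. local_noetherian.prime_chain M I (length (t # ts)) P M \<and> foldl (adjoin M) I (t # ts) = M"
    using xs by blast
qed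

sublocale local_noetherian M I
  by (rule parameters)

lemma anisotropic_I:
  assumes "finite A" "anisotropic n A c M M"
  shows "anisotropic n A c I I"
proof -
  obtain t ts P where t: "gens I (t # ts) = M" "prime_chain (length (t # ts)) P M"
    using parameters(2) by blast
  then have "I \<subseteq> P" using prime_chainD by blast
  then show ?thesis
    using anisotropic_regular[OF assms t(1) cprime_saturated[OF prime_I I_subset_M] order_refl t(2)] by blast
qed

text \<open>Evaluation at \<open>x\<close> identifies the quotient by \<open>M\<close> with k, so
  the level of k decides anisotropy modulo \<open>M\<close>.\<close>

lemma anisotropic_M_iff:
  "anisotropic n A c M M \<longleftrightarrow>
    (\<forall>h. (\<Sum>i\<in>A. mpoly_eval x (c i) * mpoly_eval x (h i) ^ n) = 0 \<longrightarrow> (\<forall>i\<in>A. mpoly_eval x (h i) = 0))"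
  by (auto simp: anisotropic_def in_M_iff mpoly_eval_sum mpoly_eval_mult mpoly_eval_power image_subset_iff)

text \<open>One \<open>R\<close> serves for both k[V] and k(V). The element with image
  \<open>\<phi> p\<close> is a sum of \<open>s + 1\<close> powers; a shorter sum would be a
  nontrivial zero of the form in \<open>anisotropic_uniformizer\<close>.\<close>

lemma level_bound:
  assumes n: "0 < n" and m: "m = free_part CHAR('k) n" "m \<noteq> 1"
    and fin: "level n (base_field TYPE('k)) < \<infinity>"
    and R: "fraction_hom R \<phi> I T" and g: "waring_bound n R g"
  shows "level m (base_field TYPE('k)) + 1 \<le> enat g"
proof -
  interpret R: fraction_hom R \<phi> I T by fact
  obtain q where q: "n = m * q" "0 < m" "0 < q" "of_nat m \<noteq> (0::'k)"
    and "\<forall>x y :: ('s, 'k) mpoly. (x + y) ^ q = x ^ q + y ^ q"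
    using free_part_decompose[where 'k = 'k and 's = 's, OF n] unfolding m by (elim exE conjE)
  note add = this(5)[rule_format]
  have m1: "1 < m" using q m by linarith
  obtain s a where s: "level m (base_field TYPE('k)) = enat s" "0 < s" "(- 1 :: 'k) = (\<Sum>i<s. a i ^ m)"
    by (rule level_witness[OF level_free_part_le[OF q(1) fin]])
  obtain t ts P where t: "gens I (t # ts) = M" "prime_chain (length (t # ts)) P M"
    using parameters(2) by blast
  have "t \<in> M" using gens_Cons_M[OF cprime_saturated[OF prime_I I_subset_M] t(1)] by blast
  then have t0: "mpoly_eval x t = 0" by (simp add: in_M_iff)
  \<comment> \<open>The cofactor of \<open>t\<close> in (1 + t)^m - 1. Its value at \<open>x\<close>
    is m, which is nonzero in k.\<close>
  define w where "w = (\<Sum>i<m. (1 + t) ^ i)"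
  have w: "w \<notin> M" using q(4) t0 by (simp add: w_def in_M_iff mpoly_eval_sum mpoly_eval_power mpoly_eval_add)
  have tw: "t * w = (1 + t) ^ m - 1"
    using power_diff_1_eq[of "1 + t" m] by (simp add: w_def)
  have "anisotropic m {..<s} (\<lambda>_. 1) M M"
    unfolding anisotropic_M_iff
  proof (intro allI impI ballI, rule ccontr)
    fix h i
    assume "(\<Sum>i<s. mpoly_eval x 1 * mpoly_eval x (h i) ^ m) = 0" "i \<in> {..<s}" "mpoly_eval x (h i) \<noteq> 0"
    then have "level m (base_field TYPE('k)) \<le> enat (s - 1)"
      using level_le_card[of "{..<s}" i "\<lambda>i. mpoly_eval x (h i)" m] by simp
    then show False using s by simp
  qed
  note an = anisotropic_uniformizer[OF prime_I I_subset_M t this m1 w]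
  \<comment> \<open>This is the \<open>q\<close>-th power of \<open>t * w\<close>, since the
    constants \<open>a i ^ m\<close> add up to -1; it is written with exponent \<open>n\<close> so
    that it is visibly a sum of \<open>s + 1\<close> n-th powers.\<close>
  define p where "p = (1 + t) ^ n + (\<Sum>i<s. mpoly_const (a i) ^ n)"
  define b where "b i = (if i < s then mpoly_const (a i) else 1 + t)" for i
  have "p = (\<Sum>i<Suc s. b i ^ n)" by (simp add: p_def b_def add.commute)
  then have "sum_of_powers R n (Suc s) (\<phi> p)"
    unfolding R.sum_of_powers_hom_iff
    by (intro bexI[of _ 1] exI[of _ b]) (simp_all add: R.zero_in_ker R.one_denom)
  then obtain h where "h \<le> g" "sum_of_powers R n h (\<phi> p)"
    using waring_boundD[OF g R.hom_closed] by blast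
  then obtain u c where u: "u \<in> T" "u ^ n * p - (\<Sum>i<h. c i ^ n) \<in> I"
    unfolding R.sum_of_powers_hom_iff by blast
  have "p = (t * w) ^ q"
  proof -
    have "(mpoly_const (- 1) :: ('s, 'k) mpoly) = (\<Sum>i<s. mpoly_const (a i) ^ m)"
      unfolding s(3) by (simp add: mpoly_const_sum mpoly_const_power)
    then have "t * w = (1 + t) ^ m + (\<Sum>i<s. mpoly_const (a i) ^ m)"
      using tw by (simp add: mpoly_const_uminus)
    then show ?thesis
      by (simp add: p_def add q(1) power_mult additive_power_sum[OF add q(3), unfolded power_mult])
  qed
  then have "(u ^ m * (t * w)) ^ q - (\<Sum>i<h. c i ^ m) ^ q \<in> I"
    using u(2) additive_power_sum[OF add q(3), of c m "{..<h}"] by (simp add: q(1) power_mult power_mult_distrib)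
  then have f: "u ^ m * (t * w) - (\<Sum>i<h. c i ^ m) \<in> I"
    by (rule additive_power_cancel[OF add prime_I])
  have "s < h"
  proof (rule ccontr)
    assume "\<not> s < h"
    \<comment> \<open>A sum of \<open>h\<close> \<le> \<open>s\<close> powers is padded with zeros
      to \<open>s\<close> coordinates; the denominator \<open>u\<close>, which is not in
      \<open>I\<close>, is the value at index \<open>s\<close> and makes the zero
      nontrivial.\<close>
    define H where "H i = (if i < h then c i else if i < s then 0 else u)" for i
    have sums: "{..s} = insert s {..<s}" by auto
    have "(\<Sum>i<s. (if i < s then 1 else - (t * w)) * H i ^ m) = (\<Sum>i<s. H i ^ m)"
      by (rule sum.cong) auto
    also have "\<dots> = (\<Sum>i<h. c i ^ m)"
      by (rule sum.mono_neutral_cong_right) (use \<open>\<not> s < h\<close> q(2) in \<open>auto simp: H_def zero_power\<close>)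
    finally have "(\<Sum>i\<le>s. (if i < s then 1 else - (t * w)) * H i ^ m)
        = - (u ^ m * (t * w) - (\<Sum>i<h. c i ^ m))"
      unfolding sums using \<open>\<not> s < h\<close> by (simp add: H_def algebra_simps)
    then have "(\<Sum>i\<le>s. (if i < s then 1 else - (t * w)) * H i ^ m) \<in> I"
      using cideal_uminus[OF cprime_cideal[OF prime_I] f] by simp
    then have "H s \<in> I" using an unfolding anisotropic_def by (meson atMost_iff image_subset_iff order_refl)
    then show False using R.denom_notin[OF u(1)] \<open>\<not> s < h\<close> by (simp add: H_def)
  qed
  then show ?thesis using s(1) \<open>h \<le> g\<close> by (simp add: one_enat_def)
qed

text \<open>Suppose the constant \<open>y\<close> becomes a sum of \<open>h'\<close> powers in
  \<open>R\<close> but is none in k. Then X_1^n + ... + X_h'^n - y X_0^n is anisotropic over k: a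
  zero with X_0 nonzero would represent \<open>y\<close>, and one with X_0 = 0 would make the level
  finite. Its lift to \<open>I\<close> contradicts the relation in \<open>R\<close>.\<close>

lemma waring_bound_base_field:
  assumes n: "0 < n" and inf: "level n (base_field TYPE('k)) = \<infinity>"
    and R: "fraction_hom R \<phi> I T" and g: "waring_bound n R g"
  shows "waring_bound n (base_field TYPE('k)) g"
proof (rule waring_boundI)
  interpret R: fraction_hom R \<phi> I T by fact
  show "0 < g" using g by (rule waring_bound_pos)
  fix y :: 'k and h
  assume "sum_of_powers (base_field TYPE('k)) n h y"
  then obtain a where a: "y = (\<Sum>i<h. a i ^ n)" by (auto simp: sum_of_powers_base_field)
  have "(mpoly_const y :: ('s, 'k) mpoly) = (\<Sum>i<h. mpoly_const (a i) ^ n)"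
    unfolding a by (simp add: mpoly_const_sum mpoly_const_power)
  then have "sum_of_powers R n h (\<phi> (mpoly_const y))"
    unfolding R.sum_of_powers_hom_iff
    by (intro bexI[of _ 1] exI[of _ "\<lambda>i. mpoly_const (a i)"]) (simp_all add: R.zero_in_ker R.one_denom)
  then obtain h' where h': "h' \<le> g" "sum_of_powers R n h' (\<phi> (mpoly_const y))"
    using waring_boundD[OF g R.hom_closed] by blast
  then obtain u c where u: "u \<in> T" "u ^ n * mpoly_const y - (\<Sum>i<h'. c i ^ n) \<in> I"
    unfolding R.sum_of_powers_hom_iff by blast
  have "\<exists>b. y = (\<Sum>i<h'. b i ^ n)"
  proof (rule ccontr)
    assume none: "\<not> ?thesis"
    define d where "d i = (if i < h' then 1 else - mpoly_const y :: ('s, 'k) mpoly)" for i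
    have split: "(\<Sum>i\<in>{..h'}. F i) = (\<Sum>i<h'. F i) + F h'" for F :: "nat \<Rightarrow> 'z::comm_monoid_add"
      by (simp flip: lessThan_Suc_atMost)
    have "anisotropic n {..h'} d M M"
      unfolding anisotropic_M_iff
    proof (intro allI impI)
      fix H :: "nat \<Rightarrow> ('s, 'k) mpoly"
      let ?e = "\<lambda>i. mpoly_eval x (H i)"
      assume "(\<Sum>i\<le>h'. mpoly_eval x (d i) * ?e i ^ n) = 0"
      then have eq: "(\<Sum>i<h'. ?e i ^ n) = y * ?e h' ^ n"
        unfolding split by (simp add: d_def mpoly_eval_uminus)
      have "?e h' = 0"
      proof (rule ccontr)
        assume "?e h' \<noteq> 0"
        then have "y = (\<Sum>i<h'. (?e i / ?e h') ^ n)"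
          using eq by (simp add: power_divide flip: sum_divide_distrib)
        then have "\<exists>b. y = (\<Sum>i<h'. b i ^ n)" by (rule exI[of _ "\<lambda>i. ?e i / ?e h'"])
        then show False using none by contradiction
      qed
      moreover have "?e i = 0" if i: "i < h'" for i
      proof (rule ccontr)
        assume "?e i \<noteq> 0"
        moreover have "(\<Sum>i<h'. ?e i ^ n) = 0" using eq \<open>?e h' = 0\<close> n by (simp add: zero_power)
        ultimately have "level n (base_field TYPE('k)) \<le> enat (h' - 1)"
            by (intro order_trans[OF level_le_card[of "{..<h'}" i ?e n]]) (use i in auto)
        then show False using inf by simp
      qed
      ultimately show "\<forall>i\<in>{..h'}. ?e i = 0" by (auto simp: le_less)
    qed
    then have an: "anisotropic n {..h'} d I I" by (intro anisotropic_I) auto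
    \<comment> \<open>The last coordinate is the common denominator of the relation, hence outside
      \<open>I\<close>.\<close>
    define H where "H i = (if i < h' then c i else u)" for i
    have "(\<Sum>i\<in>{..h'}. d i * H i ^ n) = - (u ^ n * mpoly_const y - (\<Sum>i<h'. c i ^ n))"
      unfolding split by (simp add: d_def H_def algebra_simps)
    then have "(\<Sum>i\<in>{..h'}. d i * H i ^ n) \<in> I"
      using cideal_uminus[OF cprime_cideal[OF prime_I] u(2)] by simp
    then have "H h' \<in> I" using an unfolding anisotropic_def by (meson atMost_iff image_subset_iff order_refl)
    then show False using R.denom_notin[OF u(1)] by (simp add: H_def)
  qed
  then have "sum_of_powers (base_field TYPE('k)) n h' y" unfolding sum_of_powers_base_field .
  then show "\<exists>h\<le>g. sum_of_powers (base_field TYPE('k)) n h y" using h'(1) by blast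
qed

end

text \<open>The case \<open>m = 1\<close> is kept apart because there \<open>n\<close> is a positive
  power of the characteristic. Then n-th powers are closed under addition, so both Waring numbers on
  the left are 1, whereas s_1(k) + 1 = 2; only the comparison with w_1(k) survives.\<close>

theorem theorem6p3:
  fixes V :: "('k::field ^ 's::finite) set" and n m :: nat
  assumes "n > 1"
    and "irreducible_algebraic_set V"
    and "\<forall>x. V \<noteq> {x}"
    and "\<exists>x. regular_point V x"
    and "m = free_part CHAR('k) n"
  shows "(level n (base_field TYPE('k)) < \<infinity> \<longrightarrow>
            (m \<noteq> 1 \<longrightarrow>
               waring_number n (coordinate_ring V)
                 \<ge> max (waring_number m (base_field TYPE('k))) (level m (base_field TYPE('k)) + 1) \<and>
               waring_number n (function_field V) \<ge> level m (base_field TYPE('k)) + 1) \<and>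
            (m = 1 \<longrightarrow>
               waring_number n (coordinate_ring V) \<ge> waring_number m (base_field TYPE('k))))
       \<and> (level n (base_field TYPE('k)) = \<infinity> \<longrightarrow>
            waring_number n (coordinate_ring V) \<ge> waring_number n (function_field V) \<and>
            waring_number n (function_field V) \<ge> waring_number n (base_field TYPE('k)))"
proof -
  obtain x where "regular_point V x" using assms(4) by blast
  then interpret regular_variety V x using assms(2,3) by unfold_locales
  obtain \<psi> where K: "fraction_hom (function_field V) \<psi> I (- I)" using function_field_hom by blast
  have n: "0 < n" using assms(1) by simp
  have base: "waring_number m (base_field TYPE('k)) \<le> waring_number n (coordinate_ring V)"
    unfolding assms(5) by (rule waring_number_mono) (rule waring_bound_coordinate_ring[OF irreducible in_V n])
  have levels: "level m (base_field TYPE('k)) + 1 \<le> waring_number n (coordinate_ring V)"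
    "level m (base_field TYPE('k)) + 1 \<le> waring_number n (function_field V)"
    if "level n (base_field TYPE('k)) < \<infinity>" "m \<noteq> 1"
    by (rule waring_number_geI, rule level_bound[OF n assms(5) that(2,1)], rule coordinate_hom K, assumption)+
  have "waring_number n (function_field V) \<le> waring_number n (coordinate_ring V)"
    by (rule waring_number_mono) (rule waring_bound_fractions[OF coordinate_hom K])
  moreover have "waring_number n (base_field TYPE('k)) \<le> waring_number n (function_field V)"
    if "level n (base_field TYPE('k)) = \<infinity>"
    by (rule waring_number_mono) (rule waring_bound_base_field[OF n that K])
  ultimately show ?thesis using base levels by (intro conjI impI max.boundedI) blast+
qed

end
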